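(* Let $(X_j:j\ge 1)$ be an i.i.d. sequence of random variables for which there exist positive constants $\theta^*$ and $\varepsilon$ such that $\mathbb{E}\exp(\theta X_1)<\infty$ for $|\theta-\theta^*|<\varepsilon$ and $\mathbb{E}\exp(\theta^*X_1)=1$. Let $S_0=0$ and $S_n=X_1+\cdots+X_n$ for $n\ge1$. Suppose that $(\xi_j:j\ge 0)$ is a stationary sequence independent of $(X_j:j\ge 1)$, for which $\mathbb{E}\exp(\theta\xi_j)<\infty$ for $\theta$ in a neighborhood of $\theta^*$, and let $M_\infty=\max\{S_k+\xi_k:k\ge 0\}$. If $X_1$ is spread-out, then there exists a positive constant $c$ such that $$\mathbb{P}(M_\infty>x)\sim c\exp(-\theta^*x)\qquad\text{as } x\to\infty.$$
   Context: All random variables are real-valued. A random variable $X_1$ (or its distribution $F$) is spread-out if for some $n\ge 1$ the $n$-fold convolution $F^{*n}$ has a nontrivial component that is absolutely continuous with respect to Lebesgue measure. $f(x)\sim g(x)$ as $x\to\infty$ means $f(x)/g(x)\to 1$. *)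

theory Defs
  imports "HOL-Probability.Probability" "HOL-Library.Landau_Symbols"
begin

text \<open>The \<open>n\<close>-fold convolution of a distribution with itself; the zeroth power is the point mass at 0.\<close>

primrec conv_power :: "real measure \<Rightarrow> nat \<Rightarrow> real measure" where
  "conv_power F 0 = return borel 0"
| "conv_power F (Suc n) = convolution F (conv_power F n)"

text \<open>
  A nontrivial absolutely continuous component of a convolution power is a nonzero summand \<open>\<nu>\<close>
  in a decomposition of that measure into two (nonnegative) Borel measures, where
  \<open>\<nu>\<close> is absolutely continuous with respect to Lebesgue measure. The other summand \<open>\<sigma>\<close> is
  not required to be singular.
\<close>

definition spread_out :: "real measure \<Rightarrow> bool" where
  "spread_out F \<longleftrightarrow>
    (\<exists>n\<ge>1. \<exists>\<nu> \<sigma> :: real measure.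
        sets \<nu> = sets borel \<and> sets \<sigma> = sets borel \<and>
        (\<forall>A\<in>sets borel. emeasure (conv_power F n) A = emeasure \<nu> A + emeasure \<sigma> A) \<and>
        absolutely_continuous lborel \<nu> \<and> emeasure \<nu> UNIV \<noteq> 0)"

context prob_space
begin

text \<open>Strict stationarity: the law of the whole sequence is invariant under all shifts.\<close>

definition stationary_sequence :: "(nat \<Rightarrow> 'a \<Rightarrow> real) \<Rightarrow> bool" where
  "stationary_sequence \<xi> \<longleftrightarrow>
    (\<forall>j. random_variable borel (\<xi> j)) \<and>
    (\<forall>h. distr M (\<Pi>\<^sub>M j\<in>UNIV. borel) (\<lambda>\<omega> j. \<xi> (j + h) \<omega>) =
         distr M (\<Pi>\<^sub>M j\<in>UNIV. borel) (\<lambda>\<omega> j. \<xi> j \<omega>))"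

definition iid_sequence :: "(nat \<Rightarrow> 'a \<Rightarrow> real) \<Rightarrow> bool" where
  "iid_sequence X \<longleftrightarrow>
    indep_vars (\<lambda>_. borel) X {1..} \<and>
    (\<forall>j\<ge>1. distr M borel (X j) = distr M borel (X 1))"

text \<open>Independence of the two sequences as random elements of sequence space, not merely
  of \<open>X j\<close> and \<open>\<xi> j\<close> for each \<open>j\<close>.\<close>

definition indep_sequences :: "(nat \<Rightarrow> 'a \<Rightarrow> real) \<Rightarrow> (nat \<Rightarrow> 'a \<Rightarrow> real) \<Rightarrow> bool" where
  "indep_sequences X \<xi> \<longleftrightarrow>
    indep_var (\<Pi>\<^sub>M j\<in>{1..}. borel) (\<lambda>\<omega>. \<lambda>j\<in>{1..}. X j \<omega>)
              (\<Pi>\<^sub>M j\<in>UNIV. borel) (\<lambda>\<omega> j. \<xi> j \<omega>)"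

end

text \<open>Only the increments \<open>X 1, X 2, \<dots>\<close> are used; \<open>X 0\<close> is irrelevant.\<close>

definition walk :: "(nat \<Rightarrow> 'a \<Rightarrow> real) \<Rightarrow> nat \<Rightarrow> 'a \<Rightarrow> real" where
  "walk X n \<omega> = (\<Sum>j=1..n. X j \<omega>)"

text \<open>The maximum of the perturbed walk is taken as a supremum in the extended reals. It
  agrees with the maximum whenever that is attained, and it stays meaningful on the null set where the
  perturbed walk may be unbounded above.\<close>

definition perturbed_max :: "(nat \<Rightarrow> 'a \<Rightarrow> real) \<Rightarrow> (nat \<Rightarrow> 'a \<Rightarrow> real) \<Rightarrow> 'a \<Rightarrow> ereal" where
  "perturbed_max X \<xi> \<omega> = (SUP k. ereal (walk X k \<omega> + \<xi> k \<omega>))"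

end

(*
  With F the law of X_1 and R(x) = P(M_oo > x), dropping the term k = 0 and using stationarity gives
  R(x) >= int R(x - y) F(dy).  Hence Z(x) = exp(theta x) R(x) is superharmonic for the tilted law
  G(dy) = exp(theta y) F(dy), which has positive mean mu.  A maximum principle for the renewal
  function of the walk bounds Z.  The antiderivative W of Z, taken from -oo, is Lipschitz, and
  H = W - G*W is nondecreasing and bounded, with limit I > 0.  Any limit D of the increments
  W(x_n + a) - W(x_n) along x_n -> oo satisfies D = I + G*D, so by a Choquet-Deny argument the
  increments D(x + a) - D(x) have every G-typical point as a period; since F is spread-out, the closed
  group of periods has positive Lebesgue measure and is the whole line.  Hence D is linear
  with slope I / mu, and the monotonicity of R upgrades this to Z(x) -> I / mu.
*)

theory Submission
  imports Defs "HOL-Complex_Analysis.Great_Picard" "HOL-Real_Asymp.Real_Asymp"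
begin

section \<open>Harmonic functions and their periods\<close>

text \<open>At the critical exponent the union bound over k meets a divergent series of ones, so
  even boundedness of Z needs an argument. The remedy is a second exponent \<eta> strictly between 0
  and \<theta>. The moment generating function of F is strictly convex and equals 1 at 0 and at
  \<theta>, so it is below 1 at \<eta> and the geometric series converges there. The same \<eta>
  gives Z the decay exp((\<theta> - \<eta>) x) at -oo, hence a finite W, and averaging against G
  multiplies this exponential by a factor below 1; this excludes I = 0. The tail R obeys only an
  inequality, whose defect depends on the joint law of the perturbations and is never estimated.
  After integration the sign of the defect is enough: it makes W - G*W monotone, and a bounded
  monotone function has a limit. Integration also supplies the equicontinuity from which D is
  extracted, as R itself may jump. Since D is unbounded, the harmonic argument is applied to its
  increments, in which the constant I cancels.\<close>

lemma (in prob_space) square_expectation_le: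
  fixes f :: "'a \<Rightarrow> real"
  assumes "integrable M f" "integrable M (\<lambda>x. (f x)\<^sup>2)"
  shows "(expectation f)\<^sup>2 \<le> expectation (\<lambda>x. (f x)\<^sup>2)"
  using variance_positive[of f] variance_eq[OF assms] by simp

context real_distribution
begin

text \<open>Let \<open>\<psi> x\<close> be the mean squared increment of \<open>\<zeta>\<close> over one step. Harmonicity gives
  \<open>\<psi> = A (\<zeta>\<^sup>2) - \<zeta>\<^sup>2\<close> for the averaging operator \<open>A\<close>, and Jensen gives \<open>\<psi> \<le> A \<psi>\<close>. Hence
  \<open>n \<psi> + \<zeta>\<^sup>2\<close> is bounded uniformly in \<open>n\<close>, which forces \<open>\<psi> = 0\<close>.\<close>

lemma bounded_harmonic_AE_period:
  fixes \<zeta> :: "real \<Rightarrow> real"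
  assumes cont: "continuous_on UNIV \<zeta>" and bnd: "\<And>x. \<bar>\<zeta> x\<bar> \<le> B"
    and harm: "\<And>x. \<zeta> x = (\<integral>y. \<zeta> (x - y) \<partial>M)"
  shows "AE y in M. \<forall>x. \<zeta> (x - y) = \<zeta> x"
proof -
  have [measurable]: "\<zeta> \<in> borel_measurable borel"
    using cont by (rule borel_measurable_continuous_onI)
  interpret P: pair_sigma_finite M M ..
  define q where "q x = (\<zeta> x)\<^sup>2" for x
  define \<psi> where "\<psi> x = (\<integral>y. (\<zeta> x - \<zeta> (x - y))\<^sup>2 \<partial>M)" for x
  have [measurable]: "q \<in> borel_measurable borel" "\<psi> \<in> borel_measurable borel"
    unfolding q_def \<psi>_def by measurable
  have q_bnd: "\<bar>q x\<bar> \<le> B\<^sup>2" for x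
    using power_mono[OF bnd[of x], of 2] by (simp add: q_def)
  have diff_bnd: "\<bar>(\<zeta> x - \<zeta> y)\<^sup>2\<bar> \<le> (2 * B)\<^sup>2" for x y
  proof -
    have "\<bar>\<zeta> x - \<zeta> y\<bar> \<le> 2 * B" using bnd[of x] bnd[of y] by linarith
    from power_mono[OF this, of 2] show ?thesis by simp
  qed
  have int: "integrable M f" if "f \<in> borel_measurable borel" "\<And>x. \<bar>f x\<bar> \<le> K" for f :: "real \<Rightarrow> real" and K
    using that by (intro integrable_const_bound[of _ K]) auto
  have int_\<zeta>: "integrable M (\<lambda>y. \<zeta> (x - y))" for x
    by (rule int[of _ B]) (use bnd in auto)
  have int_q: "integrable M (\<lambda>y. q (x - y))" for x
    by (rule int[of _ "B\<^sup>2"]) (use q_bnd in auto)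
  have \<psi>_eq: "\<psi> x = (\<integral>y. q (x - y) \<partial>M) - q x" for x
  proof -
    have "\<psi> x = (\<integral>y. q x - 2 * \<zeta> x * \<zeta> (x - y) + q (x - y) \<partial>M)"
      unfolding \<psi>_def q_def by (intro Bochner_Integration.integral_cong) (auto simp: power2_eq_square algebra_simps)
    also have "\<dots> = q x - 2 * \<zeta> x * \<zeta> x + (\<integral>y. q (x - y) \<partial>M)"
      using int_\<zeta>[of x] int_q[of x] harm[of x] prob_space by simp
    finally show ?thesis by (simp add: q_def power2_eq_square)
  qed
  have \<psi>_nonneg: "0 \<le> \<psi> x" for x
    unfolding \<psi>_def by simp
  have \<psi>_bnd: "\<bar>\<psi> x\<bar> \<le> (2 * B)\<^sup>2" for x
  proof -
    have "\<psi> x \<le> (\<integral>y. (2 * B)\<^sup>2 \<partial>M)"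
      unfolding \<psi>_def
      by (intro integral_mono int[of _ "(2 * B)\<^sup>2"]) (use diff_bnd[of x] in \<open>auto intro: order_trans[OF abs_ge_self]\<close>)
    with \<psi>_nonneg[of x] prob_space show ?thesis by simp
  qed
  have int_\<psi>: "integrable M (\<lambda>y. \<psi> (x - y))" for x
    by (rule int[of _ "(2 * B)\<^sup>2"]) (use \<psi>_bnd in auto)
  have \<psi>_subharm: "\<psi> x \<le> (\<integral>z. \<psi> (x - z) \<partial>M)" for x
  proof -
    \<comment> \<open>For fixed y the difference \<zeta> x - \<zeta> (x - y) is harmonic in x, so
      its square is at most the averaged square.\<close>
    have "(\<zeta> x - \<zeta> (x - y))\<^sup>2 \<le> (\<integral>z. (\<zeta> (x - z) - \<zeta> (x - z - y))\<^sup>2 \<partial>M)" for y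
    proof -
      have "\<zeta> (x - y) = (\<integral>z. \<zeta> (x - z - y) \<partial>M)"
        by (subst harm) (simp add: algebra_simps)
      moreover have "integrable M (\<lambda>z. \<zeta> (x - z - y))"
        by (rule int[of _ B]) (use bnd in auto)
      ultimately have "\<zeta> x - \<zeta> (x - y) = (\<integral>z. \<zeta> (x - z) - \<zeta> (x - z - y) \<partial>M)"
        using int_\<zeta>[of x] harm[of x] by simp
      moreover have "(\<integral>z. \<zeta> (x - z) - \<zeta> (x - z - y) \<partial>M)\<^sup>2 \<le> (\<integral>z. (\<zeta> (x - z) - \<zeta> (x - z - y))\<^sup>2 \<partial>M)"
      proof (rule square_expectation_le)
        show "integrable M (\<lambda>z. \<zeta> (x - z) - \<zeta> (x - z - y))"
          using int_\<zeta>[of x] \<open>integrable M (\<lambda>z. \<zeta> (x - z - y))\<close> by simp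
        show "integrable M (\<lambda>z. (\<zeta> (x - z) - \<zeta> (x - z - y))\<^sup>2)"
          by (rule int[of _ "(2 * B)\<^sup>2"]) (use diff_bnd in auto)
      qed
      ultimately show ?thesis by simp
    qed
    then have "\<psi> x \<le> (\<integral>y. (\<integral>z. (\<zeta> (x - z) - \<zeta> (x - z - y))\<^sup>2 \<partial>M) \<partial>M)"
      unfolding \<psi>_def
    proof (intro integral_mono)
      show "integrable M (\<lambda>y. (\<zeta> x - \<zeta> (x - y))\<^sup>2)"
        by (rule int[of _ "(2 * B)\<^sup>2"]) (use diff_bnd in auto)
      show "integrable M (\<lambda>y. \<integral>z. (\<zeta> (x - z) - \<zeta> (x - z - y))\<^sup>2 \<partial>M)"
      proof (rule int[of _ "(2 * B)\<^sup>2"])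
        show "\<bar>\<integral>z. (\<zeta> (x - z) - \<zeta> (x - z - y))\<^sup>2 \<partial>M\<bar> \<le> (2 * B)\<^sup>2" for y
        proof -
          have "(\<integral>z. (\<zeta> (x - z) - \<zeta> (x - z - y))\<^sup>2 \<partial>M) \<le> (\<integral>z. (2 * B)\<^sup>2 \<partial>M)"
            by (intro integral_mono int[of _ "(2 * B)\<^sup>2"])
              (use diff_bnd in \<open>auto intro: order_trans[OF abs_ge_self]\<close>)
          then show ?thesis using prob_space by simp
        qed
      qed measurable
    qed auto
    also have "\<dots> = (\<integral>z. (\<integral>y. (\<zeta> (x - z) - \<zeta> (x - z - y))\<^sup>2 \<partial>M) \<partial>M)"
    proof (rule P.Fubini_integral)
      interpret PP: pair_prob_space M M ..
      show "integrable (M \<Otimes>\<^sub>M M) (\<lambda>(z, y). (\<zeta> (x - z) - \<zeta> (x - z - y))\<^sup>2)"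
        by (rule PP.integrable_const_bound[where B = "(2 * B)\<^sup>2"]) (use diff_bnd in auto)
    qed
    finally show ?thesis by (simp add: \<psi>_def)
  qed
  \<comment> \<open>The term \<open>q\<close> is carried along to close the induction: by
    \<open>\<psi>_eq\<close> one copy of \<psi> x together with \<open>q x\<close> is the average of
    \<open>q\<close>, and subharmonicity averages the other n copies.\<close>
  have iter: "real n * \<psi> x + q x \<le> B\<^sup>2" for n x
  proof (induction n arbitrary: x)
    case 0
    show ?case using q_bnd[of x] by simp
  next
    case (Suc n)
    have "real (Suc n) * \<psi> x + q x \<le> real n * (\<integral>z. \<psi> (x - z) \<partial>M) + (\<integral>z. q (x - z) \<partial>M)"
    proof -
      have "real n * \<psi> x \<le> real n * (\<integral>z. \<psi> (x - z) \<partial>M)"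
        using \<psi>_subharm[of x] by (rule mult_left_mono) simp
      moreover have "real (Suc n) * \<psi> x = real n * \<psi> x + \<psi> x"
        by (simp add: distrib_right)
      ultimately show ?thesis using \<psi>_eq[of x] by linarith
    qed
    also have "\<dots> = (\<integral>z. real n * \<psi> (x - z) + q (x - z) \<partial>M)"
      using int_\<psi> int_q by simp
    also have "\<dots> \<le> (\<integral>z. B\<^sup>2 \<partial>M)"
      using int_\<psi> int_q Suc.IH by (intro integral_mono) auto
    finally show ?case using prob_space by simp
  qed
  have "\<psi> x = 0" for x
  proof (rule ccontr)
    assume "\<psi> x \<noteq> 0"
    then obtain n where "B\<^sup>2 < real n * \<psi> x"
      using \<psi>_nonneg[of x] by (metis antisym_conv2 reals_Archimedean3)
    then show False using iter[of n x] by (simp add: q_def) (smt (verit) zero_le_power2)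
  qed
  then have "AE y in M. (\<zeta> x - \<zeta> (x - y))\<^sup>2 = 0" for x
    unfolding \<psi>_def
    by (subst integral_nonneg_eq_0_iff_AE[symmetric]) (auto intro!: int[of _ "(2 * B)\<^sup>2"] simp: diff_bnd[simplified])
  \<comment> \<open>The exceptional null set depends on x, so only countably many of them are
    united; continuity of \<zeta> extends the identity from the rationals to all x.\<close>
  then have "AE y in M. \<forall>x\<in>\<rat>. (\<zeta> x - \<zeta> (x - y))\<^sup>2 = 0"
    by (subst AE_ball_countable) (auto simp: countable_rat)
  then show ?thesis
  proof eventually_elim
    case (elim y)
    have "x \<in> {x. \<zeta> (x - y) = \<zeta> x}" for x
    proof -
      have "closed {x. \<zeta> (x - y) = \<zeta> x}"
        by (intro closed_Collect_eq continuous_on_compose2[OF cont]) (auto intro!: continuous_intros cont)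
      moreover have "\<rat> \<subseteq> {x. \<zeta> (x - y) = \<zeta> x}" using elim by auto
      ultimately have "closure \<rat> \<subseteq> {x. \<zeta> (x - y) = \<zeta> x}" by (rule closure_minimal[rotated])
      then show ?thesis using Rats_closure_real by auto
    qed
    then show ?case by auto
  qed
qed

end

text \<open>If the positive elements stay above some e, distinct elements are at least e apart, so
  the group is countable and null. Otherwise it has arbitrarily small positive elements, whose
  integer multiples are dense.\<close>

lemma closed_subgroup_eq_UNIV:
  fixes P :: "real set"
  assumes closed: "closed P" and zero: "0 \<in> P" and diff: "\<And>x y. x \<in> P \<Longrightarrow> y \<in> P \<Longrightarrow> x - y \<in> P"
    and non_null: "emeasure lborel P \<noteq> 0"
  shows "P = UNIV"
proof -
  have minus: "- x \<in> P" if "x \<in> P" for x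
    using diff[OF zero that] by simp
  have nat_mult: "real n * x \<in> P" if "x \<in> P" for n x
  proof (induction n)
    case (Suc n)
    then show ?case using diff[OF Suc minus[OF that]] by (simp add: algebra_simps)
  qed (use zero in auto)
  have int_mult: "of_int k * x \<in> P" if "x \<in> P" for k :: int and x
    using nat_mult[OF that, of "nat k"] minus[OF nat_mult[OF that, of "nat (- k)"]]
    by (cases "k \<ge> 0") auto
  have small: "\<exists>p\<in>P. 0 < p \<and> p < e" if "e > 0" for e
  proof (rule ccontr)
    assume no: "\<not> (\<exists>p\<in>P. 0 < p \<and> p < e)"
    \<comment> \<open>Each half-open cell of length e contains at most one element of P.\<close>
    have "P \<subseteq> (\<Union>k::int. {x \<in> P. \<lfloor>x / e\<rfloor> = k})" by auto
    moreover have "countable {x \<in> P. \<lfloor>x / e\<rfloor> = k}" for k :: int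
    proof -
      have "x = y" if "x \<in> P" "y \<in> P" "\<lfloor>x / e\<rfloor> = k" "\<lfloor>y / e\<rfloor> = k" for x y
      proof (rule ccontr)
        assume "x \<noteq> y"
        have "\<bar>x / e - y / e\<bar> < 1" using that by linarith
        then have "\<bar>x - y\<bar> < e" using \<open>e > 0\<close> by (simp add: diff_divide_distrib[symmetric] abs_divide)
        moreover have "\<bar>x - y\<bar> \<in> P" using diff that by (auto simp: abs_if)
        ultimately show False using no \<open>x \<noteq> y\<close> by auto
      qed
      then have "{x \<in> P. \<lfloor>x / e\<rfloor> = k} \<subseteq> {SOME x. x \<in> P \<and> \<lfloor>x / e\<rfloor> = k}"
        by (auto) (metis (mono_tags, lifting) someI)
      then show ?thesis by (rule countable_subset) simp
    qed
    ultimately have "countable P" by (meson countable_UN countable_subset countableI_type)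
    then show False using non_null emeasure_lborel_countable by blast
  qed
  have "x \<in> closure P" for x
  proof (unfold closure_approachable, intro allI impI)
    fix e :: real assume "e > 0"
    then obtain p where p: "p \<in> P" "0 < p" "p < e" using small by blast
    have *: "of_int \<lfloor>x / p\<rfloor> * p \<le> x" "x < (of_int \<lfloor>x / p\<rfloor> + 1) * p"
      using p(2) floor_divide_lower floor_divide_upper by auto
    have "dist (of_int \<lfloor>x / p\<rfloor> * p) x < e"
      using * p by (simp add: dist_real_def abs_if algebra_simps)
    then show "\<exists>y\<in>P. dist y x < e" using int_mult[OF p(1)] by blast
  qed
  then show ?thesis using closed by auto
qed

section \<open>Convolution powers of a spread-out law and the submonoids that carry them\<close>

lemma finite_measure_conv_power:
  assumes "real_distribution F"
  shows "finite_measure (conv_power F n) \<and> sets (conv_power F n) = sets borel"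
proof -
  interpret real_distribution F by fact
  show ?thesis
  proof (induction n)
    case 0
    show ?case using prob_space_return[of "0::real" borel] by (auto simp: prob_space_def)
  next
    case (Suc n)
    then show ?case by (auto intro: convolution_finite finite_measure_axioms)
  qed
qed

lemma AE_conv_power_submonoid:
  assumes "real_distribution F" and P[measurable]: "P \<in> sets borel" and "0 \<in> P"
    and add: "\<And>x y. x \<in> P \<Longrightarrow> y \<in> P \<Longrightarrow> x + y \<in> P"
    and AE: "AE x in F. x \<in> P"
  shows "AE x in conv_power F n. x \<in> P"
proof -
  interpret real_distribution F by fact
  show ?thesis
  proof (induction n)
    case 0
    show ?case using \<open>0 \<in> P\<close> unfolding conv_power.simps by (subst AE_return) auto
  next
    case (Suc n)
    let ?C = "conv_power F n"
    interpret C: finite_measure ?C using finite_measure_conv_power[OF assms(1), of n] by simp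
    have [measurable_cong, simp]: "sets ?C = sets borel"
      using finite_measure_conv_power[OF assms(1), of n] by simp
    interpret FC: pair_sigma_finite F ?C ..
    have "AE x in F. AE y in ?C. x + y \<in> P"
      using AE
    proof eventually_elim
      case (elim x)
      show ?case using Suc by eventually_elim (use elim add in auto)
    qed
    then have *: "AE x in F. AE y in ?C. (case (x, y) of (x, y) \<Rightarrow> x + y \<in> P)"
      by simp
    have "AE z in F \<Otimes>\<^sub>M ?C. (case z of (x, y) \<Rightarrow> x + y \<in> P)"
    proof (rule FC.AE_pair_measure[OF _ *])
      show "{z \<in> space (F \<Otimes>\<^sub>M ?C). case z of (x, y) \<Rightarrow> x + y \<in> P} \<in> sets (F \<Otimes>\<^sub>M ?C)"
        by measurable
    qed
    then show ?case
      unfolding conv_power.simps convolution_def by (subst AE_distr_iff) (auto simp: case_prod_beta')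
  qed
qed

text \<open>A submonoid carrying F carries every convolution power, hence also the component
  \<open>\<nu>\<close> dominated by one of them. A Lebesgue null set cannot carry a nonzero
  absolutely continuous measure. It is applied to {0}, which shows that F is not a point mass at 0,
  and to groups of periods.\<close>

lemma spread_out_submonoid_non_null:
  assumes "spread_out F" "real_distribution F" and P: "P \<in> sets borel" and "0 \<in> P"
    and "\<And>x y. x \<in> P \<Longrightarrow> y \<in> P \<Longrightarrow> x + y \<in> P"
    and "AE x in F. x \<in> P"
  shows "emeasure lborel P \<noteq> 0"
proof
  assume null: "emeasure lborel P = 0"
  obtain n \<nu> \<sigma> where sets: "sets \<nu> = sets borel" "sets \<sigma> = sets borel"
    and sum: "\<And>A. A \<in> sets borel \<Longrightarrow> emeasure (conv_power F n) A = emeasure \<nu> A + emeasure \<sigma> A"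
    and ac: "absolutely_continuous lborel \<nu>" and nontriv: "emeasure \<nu> UNIV \<noteq> 0"
    using assms(1) unfolding spread_out_def by blast
  have [simp]: "sets (conv_power F n) = sets borel"
    using finite_measure_conv_power[OF assms(2)] by simp
  then have [simp]: "space (conv_power F n) = UNIV"
    by (simp add: sets_eq_imp_space_eq[of _ borel])
  have "AE x in conv_power F n. x \<in> P"
    by (rule AE_conv_power_submonoid) (use assms in auto)
  then have "emeasure (conv_power F n) (- P) = 0"
    using P by (subst (asm) AE_iff_measurable[of "- P"]) auto
  then have "emeasure \<nu> (- P) = 0" using sum[of "- P"] P by auto
  moreover have "emeasure \<nu> P = 0"
    using ac null P by (auto simp: absolutely_continuous_def null_sets_def)
  ultimately have "emeasure \<nu> (P \<union> - P) = 0"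
    using P sets by (subst plus_emeasure[symmetric]) auto
  then show False using nontriv by simp
qed

section \<open>Limits of superharmonic functions\<close>

lemma continuous_on_Lipschitz_real:
  fixes f :: "real \<Rightarrow> real"
  assumes "\<And>x y. \<bar>f x - f y\<bar> \<le> C * \<bar>x - y\<bar>"
  shows "continuous_on UNIV f"
proof -
  have "0 \<le> C" using assms[of 1 0] by simp
  then have "C-lipschitz_on UNIV f" using assms by (auto simp: lipschitz_on_def dist_real_def)
  then show ?thesis by (rule lipschitz_on_continuous_on)
qed

text \<open>Subtracting the candidate linear function leaves an additive function that vanishes at
  the integers. It is determined by its values on the unit interval and so is bounded, and a bounded
  additive function is zero.\<close>

lemma additive_Lipschitz_linear:
  fixes f :: "real \<Rightarrow> real"
  assumes add: "\<And>x y. f (x + y) = f x + f y" and lip: "\<And>x. \<bar>f x\<bar> \<le> C * \<bar>x\<bar>"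
  shows "f x = x * f 1"
proof -
  define e where "e x = f x - x * f 1" for x
  have e_add: "e (x + y) = e x + e y" for x y by (simp add: e_def add algebra_simps)
  have e_nat: "e (real n * x) = real n * e x" for n x
    using lip[of 0] by (induction n) (auto simp: e_add algebra_simps, simp add: e_def)
  have e_minus: "e (- x) = - e x" for x
    using e_add[of x "- x"] e_nat[of 0 0] by simp
  have e_real: "e (real n) = 0" for n using e_nat[of n 1] by (simp add: e_def)
  then have e_int: "e (of_int k) = 0" for k
  proof (cases "k \<ge> 0")
    case True
    then show ?thesis using e_real[of "nat k"] by simp
  next
    case False
    then show ?thesis using e_real[of "nat (- k)"] e_minus[of "of_int (- k)"] by simp
  qed
  have bound: "\<bar>e x\<bar> \<le> C + \<bar>f 1\<bar>" for x
  proof -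
    have "e x = e (of_int \<lfloor>x\<rfloor>) + e (frac x)"
      by (simp add: e_add[symmetric] frac_def)
    then have "\<bar>e x\<bar> \<le> \<bar>f (frac x)\<bar> + \<bar>frac x\<bar> * \<bar>f 1\<bar>"
      using e_int abs_triangle_ineq4[of "f (frac x)" "frac x * f 1"]
      by (simp add: e_def[of "frac x"] abs_mult)
    also have "\<dots> \<le> C * \<bar>frac x\<bar> + \<bar>frac x\<bar> * \<bar>f 1\<bar>"
      using lip[of "frac x"] by simp
    also have "\<dots> \<le> C * 1 + 1 * \<bar>f 1\<bar>"
      using frac_lt_1[of x] frac_ge_0[of x] lip[of 1] by (intro add_mono mult_mono) auto
    finally show ?thesis by simp
  qed
  have "e x = 0"
  proof (rule ccontr)
    assume "e x \<noteq> 0"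
    then obtain n where "C + \<bar>f 1\<bar> < real n * \<bar>e x\<bar>"
      using reals_Archimedean3[of "\<bar>e x\<bar>"] by auto
    then show False using bound[of "real n * x"] by (simp add: e_nat abs_mult)
  qed
  then show ?thesis by (simp add: e_def)
qed

text \<open>The pointwise part of the Arzela-Ascoli theorem on the whole line: a diagonal
  subsequence converges at the rationals, and the common Lipschitz constant carries the Cauchy
  property to every real.\<close>

lemma Lipschitz_sequence_convergent_subsequence:
  fixes f :: "nat \<Rightarrow> real \<Rightarrow> real"
  assumes lip: "\<And>n x y. \<bar>f n x - f n y\<bar> \<le> C * \<bar>x - y\<bar>" and zero: "\<And>n. f n 0 = 0"
  obtains r g where "strict_mono (r :: nat \<Rightarrow> nat)" "\<And>x. (\<lambda>n. f (r n) x) \<longlonglongrightarrow> g x"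
proof -
  have "0 \<le> C" using lip[of 0 1 0] by simp
  have bnd: "norm (f n x / (1 + \<bar>x\<bar>)) \<le> C" for n x
  proof -
    have "\<bar>f n x\<bar> \<le> C * (1 + \<bar>x\<bar>)"
      using lip[of n x 0] zero[of n] \<open>0 \<le> C\<close> by (simp add: algebra_simps)
    then show ?thesis by (simp add: abs_divide field_simps)
  qed
  \<comment> \<open>The diagonal argument is used with one bound for all points, while
    \<open>f n\<close> may grow linearly; the quotient by \<open>1 + \<bar>x\<bar>\<close> is
    bounded by C.\<close>
  obtain r where r: "strict_mono (r :: nat \<Rightarrow> nat)"
    "\<And>x. x \<in> \<rat> \<Longrightarrow> \<exists>l. (\<lambda>n. f (r n) x / (1 + \<bar>x\<bar>)) \<longlonglongrightarrow> l"
    by (rule function_convergent_subsequence[OF countable_rat, where f = "\<lambda>n x. f n x / (1 + \<bar>x\<bar>)" and M = C])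
       (use bnd in auto)
  have rat: "Cauchy (\<lambda>n. f (r n) x)" if x: "x \<in> \<rat>" for x
  proof -
    obtain l where "(\<lambda>n. f (r n) x / (1 + \<bar>x\<bar>)) \<longlonglongrightarrow> l" using r(2)[OF x] by blast
    then have "(\<lambda>n. f (r n) x / (1 + \<bar>x\<bar>) * (1 + \<bar>x\<bar>)) \<longlonglongrightarrow> l * (1 + \<bar>x\<bar>)"
      by (intro tendsto_intros)
    moreover have "1 + \<bar>x\<bar> \<noteq> 0" by linarith
    ultimately show ?thesis by (auto intro: LIMSEQ_imp_Cauchy)
  qed
  have "Cauchy (\<lambda>n. f (r n) x)" for x
  proof (rule metric_CauchyI)
    fix e :: real assume "e > 0"
    define d where "d = e / (4 * (C + 1))"
    have "d > 0" using \<open>e > 0\<close> \<open>0 \<le> C\<close> by (simp add: d_def)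
    then obtain q where q: "q \<in> \<rat>" "x < q" "q < x + d" using Rats_dense_in_real[of x "x + d"] by auto
    obtain N where N: "\<And>m n. m \<ge> N \<Longrightarrow> n \<ge> N \<Longrightarrow> dist (f (r m) q) (f (r n) q) < e / 2"
      using metric_CauchyD[OF rat[OF q(1)], of "e / 2"] \<open>e > 0\<close> by auto
    have close: "\<bar>f n x - f n q\<bar> \<le> e / 4" for n
    proof -
      have "\<bar>f n x - f n q\<bar> \<le> C * d"
        using lip[of n x q] q mult_left_mono[OF _ \<open>0 \<le> C\<close>, of "\<bar>x - q\<bar>" d] by auto
      also have "\<dots> \<le> e / 4" using \<open>e > 0\<close> \<open>0 \<le> C\<close> by (simp add: d_def field_simps)
      finally show ?thesis .
    qed
    show "\<exists>N. \<forall>m\<ge>N. \<forall>n\<ge>N. dist (f (r m) x) (f (r n) x) < e"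
    proof (intro exI allI impI)
      fix m n assume "m \<ge> N" "n \<ge> N"
      from N[OF this] close[of "r m"] close[of "r n"] show "dist (f (r m) x) (f (r n) x) < e"
        unfolding dist_real_def by linarith
    qed
  qed
  then have conv: "(\<lambda>n. f (r n) x) \<longlonglongrightarrow> lim (\<lambda>n. f (r n) x)" for x
    by (simp add: Cauchy_convergent_iff convergent_LIMSEQ_iff)
  show thesis by (rule that[OF r(1) conv])
qed

lemma tendsto_at_top_subsequenceI:
  fixes f :: "real \<Rightarrow> real"
  assumes "\<And>x. filterlim x at_top sequentially \<Longrightarrow> \<exists>r. strict_mono (r :: nat \<Rightarrow> nat) \<and> (\<lambda>n. f (x (r n))) \<longlonglongrightarrow> l"
  shows "(f \<longlongrightarrow> l) at_top"
proof (rule ccontr)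
  assume "\<not> ?thesis"
  then obtain e where e: "e > 0" "\<not> (\<forall>\<^sub>F x in at_top. dist (f x) l < e)"
    unfolding tendsto_iff by blast
  then have "\<forall>n::nat. \<exists>x\<ge>real n. \<not> dist (f x) l < e"
    unfolding eventually_at_top_linorder by blast
  then obtain x where x: "\<And>n::nat. x n \<ge> real n" "\<And>n. \<not> dist (f (x n)) l < e" by metis
  have "filterlim x at_top sequentially"
    by (rule filterlim_at_top_mono[OF filterlim_real_sequentially]) (use x in auto)
  from assms[OF this] obtain r where "(\<lambda>n. f (x (r n))) \<longlonglongrightarrow> l" by blast
  then have "\<forall>\<^sub>F n in sequentially. dist (f (x (r n))) l < e" using e(1) by (simp add: tendsto_iff)
  then show False using x(2) by (auto simp: eventually_sequentially)
qed

lemma integrable_exp_lessThan: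
  fixes \<kappa> :: real assumes "\<kappa> > 0"
  shows "integrable lborel (\<lambda>s. indicator {..<t} s * exp (\<kappa> * s))"
    and "(\<integral>s. indicator {..<t} s * exp (\<kappa> * s) \<partial>lborel) = exp (\<kappa> * t) / \<kappa>"
proof -
  \<comment> \<open>The reflection s = t - u reduces the claim to the exponential integral over the
    positive half-line.\<close>
  have eq: "indicator {..<t} (t + (-1) * u) * exp (\<kappa> * (t + (-1) * u)) =
      exp (\<kappa> * t) * (indicator {0<..} u * exp (- (u * \<kappa>)))" for u
    by (auto simp: indicator_def exp_add[symmetric] algebra_simps)
  have i: "integrable lborel (\<lambda>u. indicator {0<..} u * exp (- (u * \<kappa>)))"
    using integrable_I0i_exp_mscale[OF assms] by (simp add: set_integrable_def)
  then show "integrable lborel (\<lambda>s. indicator {..<t} s * exp (\<kappa> * s))"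
    by (subst lborel_integrable_real_affine_iff[symmetric, of "-1" _ t]) (simp_all only: eq, simp_all)
  have "(\<integral>u. indicator {0<..} u * exp (- (u * \<kappa>)) \<partial>lborel) = 1 / \<kappa>"
    using LBINT_I0i_exp_mscale[OF assms] by (simp add: interval_lebesgue_integral_0_infty set_lebesgue_integral_def)
  then show "(\<integral>s. indicator {..<t} s * exp (\<kappa> * s) \<partial>lborel) = exp (\<kappa> * t) / \<kappa>"
    by (subst lborel_integral_real_affine[of "-1" _ t]) (simp_all only: eq, simp_all)
qed

text \<open>This isolates what the renewal argument takes from Z = exp(\<theta> x) R(x). The
  condition \<open>Z_mono\<close> is monotonicity of R. The number \<kappa> is \<theta> - \<eta>, so
  that \<open>exp_less_1\<close> says that the moment generating function of F is below 1 at \<eta>.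
  The condition \<open>period_eq_UNIV\<close> is what spread-out contributes: no proper closed
  subgroup carries G.\<close>

locale tilted_renewal = real_distribution G for G :: "real measure" +
  fixes Z :: "real \<Rightarrow> real" and \<theta> \<kappa> C :: real
  assumes integrable_id: "integrable G (\<lambda>y. y)"
    and mean_pos: "0 < (\<integral>y. y \<partial>G)"
    and period_eq_UNIV: "\<And>P. closed P \<Longrightarrow> 0 \<in> P \<Longrightarrow> (\<And>x y. x \<in> P \<Longrightarrow> y \<in> P \<Longrightarrow> x - y \<in> P) \<Longrightarrow>
      (AE y in G. y \<in> P) \<Longrightarrow> P = UNIV"
    and \<theta>_nonneg: "0 \<le> \<theta>" and \<kappa>_pos: "0 < \<kappa>"
    and Z_measurable[measurable]: "Z \<in> borel_measurable borel"
    and Z_nonneg: "\<And>x. 0 \<le> Z x" and Z_le: "\<And>x. Z x \<le> C" and Z_le_exp: "\<And>x. Z x \<le> C * exp (\<kappa> * x)"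
    and Z_mono: "\<And>x y. x \<le> y \<Longrightarrow> Z y \<le> exp (\<theta> * (y - x)) * Z x"
    and Z_pos: "\<exists>x. 0 < Z x"
    and integrable_exp: "integrable G (\<lambda>y. exp (- \<kappa> * y))"
    and exp_less_1: "(\<integral>y. exp (- \<kappa> * y) \<partial>G) < 1"
    and superharmonic: "\<And>x. (\<integral>y. Z (x - y) \<partial>G) \<le> Z x"
begin

section \<open>The antiderivative W and its one-step defect H\<close>

lemma C_pos: "0 < C"
  using Z_pos Z_le by (meson less_le_trans)

lemma integrable_affine_bound:
  fixes f :: "real \<Rightarrow> real"
  assumes "f \<in> borel_measurable borel" "\<And>y. \<bar>f y\<bar> \<le> a + b * \<bar>y\<bar>"
  shows "integrable G f"
proof (rule Bochner_Integration.integrable_bound)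
  show "integrable G (\<lambda>y. a + b * \<bar>y\<bar>)" using integrable_id by simp
  show "AE y in G. norm (f y) \<le> norm (a + b * \<bar>y\<bar>)"
    using assms(2) by (intro always_eventually allI) (metis abs_ge_self order_trans real_norm_def)
qed (use assms(1) in simp)

lemma integrable_indicator_Z:
  "integrable lborel (\<lambda>s. indicator {..<t} s * Z s)"
proof (rule Bochner_Integration.integrable_bound)
  show "integrable lborel (\<lambda>s. C * (indicator {..<t} s * exp (\<kappa> * s)))"
    using integrable_exp_lessThan(1)[OF \<kappa>_pos] by simp
  show "AE s in lborel. norm (indicator {..<t} s * Z s) \<le> norm (C * (indicator {..<t} s * exp (\<kappa> * s)))"
    using Z_nonneg Z_le_exp C_pos by (auto simp: indicator_def abs_mult)
qed simp

text \<open>Integrating from -oo leaves no boundary term: W - G*W is exactly the antiderivative of Z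
  - G*Z. The integral is finite by \<open>Z_le_exp\<close>.\<close>

definition W :: "real \<Rightarrow> real" where
  "W t = (\<integral>s. indicator {..<t} s * Z s \<partial>lborel)"

lemma integrable_indicator_atLeastLessThan:
  fixes f :: "real \<Rightarrow> real"
  assumes "f \<in> borel_measurable borel" "\<And>x. \<bar>f x\<bar> \<le> B"
  shows "integrable lborel (\<lambda>u. indicator {s..<t} u * f u)"
proof (rule integrableI_bounded_set[of "{s..<t}" _ _ B])
  show "emeasure lborel {s..<t} < \<infinity>" by (cases "s \<le> t") auto
qed (use assms in \<open>auto simp: indicator_def\<close>)

lemma Z_abs_le: "\<bar>Z x\<bar> \<le> C"
  using Z_nonneg Z_le by simp

lemma W_diff:
  assumes "s \<le> t"
  shows "W t - W s = (\<integral>u. indicator {s..<t} u * Z u \<partial>lborel)"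
proof -
  have "W t - W s = (\<integral>u. indicator {..<t} u * Z u - indicator {..<s} u * Z u \<partial>lborel)"
    unfolding W_def by (simp add: integrable_indicator_Z)
  also have "\<dots> = (\<integral>u. indicator {s..<t} u * Z u \<partial>lborel)"
    using assms by (intro Bochner_Integration.integral_cong) (auto simp: indicator_def)
  finally show ?thesis .
qed

lemma integral_indicator_const:
  fixes s t c :: real
  assumes "s \<le> t"
  shows "(\<integral>u. indicator {s..<t} u * c \<partial>lborel) = (t - s) * c"
  using assms by simp

lemma W_diff_le:
  assumes "s \<le> t" "\<And>u. s \<le> u \<Longrightarrow> u < t \<Longrightarrow> Z u \<le> c"
  shows "W t - W s \<le> (t - s) * c"
proof -
  have "(\<integral>u. indicator {s..<t} u * Z u \<partial>lborel) \<le> (\<integral>u. indicator {s..<t} u * c \<partial>lborel)"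
    using assms Z_abs_le
    by (intro integral_mono integrable_indicator_atLeastLessThan[of Z C]
        integrable_indicator_atLeastLessThan[of "\<lambda>_. c" "\<bar>c\<bar>"]) (auto simp: indicator_def)
  then show ?thesis using assms(1) by (simp only: W_diff integral_indicator_const)
qed

lemma W_diff_ge:
  assumes "s \<le> t" "\<And>u. s \<le> u \<Longrightarrow> u < t \<Longrightarrow> c \<le> Z u"
  shows "(t - s) * c \<le> W t - W s"
proof -
  have "(\<integral>u. indicator {s..<t} u * c \<partial>lborel) \<le> (\<integral>u. indicator {s..<t} u * Z u \<partial>lborel)"
    using assms Z_abs_le
    by (intro integral_mono integrable_indicator_atLeastLessThan[of Z C]
        integrable_indicator_atLeastLessThan[of "\<lambda>_. c" "\<bar>c\<bar>"]) (auto simp: indicator_def)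
  then show ?thesis using assms(1) by (simp only: W_diff integral_indicator_const)
qed

lemma W_nonneg: "0 \<le> W t"
  unfolding W_def using Z_nonneg by simp

lemma W_le: "W t \<le> C / \<kappa> * exp (\<kappa> * t)"
proof -
  have "W t \<le> (\<integral>s. C * (indicator {..<t} s * exp (\<kappa> * s)) \<partial>lborel)"
    unfolding W_def using integrable_exp_lessThan(1)[OF \<kappa>_pos] Z_le_exp
    by (intro integral_mono integrable_indicator_Z) (auto simp: indicator_def)
  then show ?thesis using integrable_exp_lessThan(2)[OF \<kappa>_pos, of t] by simp
qed

lemma W_Lipschitz: "\<bar>W x - W y\<bar> \<le> C * \<bar>x - y\<bar>"
proof (induction x y rule: linorder_wlog)
  case (le x y)
  have "W y - W x \<le> (y - x) * C" using le by (rule W_diff_le) (rule Z_le)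
  moreover have "(y - x) * 0 \<le> W y - W x" using le by (rule W_diff_ge) (rule Z_nonneg)
  ultimately show ?case using le by (simp add: mult.commute)
qed (simp add: abs_minus_commute)

lemma W_measurable[measurable]: "W \<in> borel_measurable borel"
  by (rule borel_measurable_continuous_onI, rule continuous_on_Lipschitz_real, rule W_Lipschitz)

lemma integrable_W: "integrable G (\<lambda>y. W (t - y))"
proof (rule integrable_affine_bound)
  show "\<bar>W (t - y)\<bar> \<le> \<bar>W t\<bar> + C * \<bar>y\<bar>" for y
    using W_Lipschitz[of "t - y" t] by simp
qed simp

definition H :: "real \<Rightarrow> real" where
  "H t = W t - (\<integral>y. W (t - y) \<partial>G)"

text \<open>By Fubini the increment of H over a window is the integral of Z - G*Z there, which is
  nonnegative by superharmonicity. The exchange is justified because the integrand is bounded by C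
  and lives on a set of finite product measure.\<close>

lemma H_mono:
  assumes "s \<le> t"
  shows "H s \<le> H t"
proof -
  interpret P: pair_sigma_finite G lborel ..
  have "(\<integral>y. W (t - y) \<partial>G) - (\<integral>y. W (s - y) \<partial>G) = (\<integral>y. W (t - y) - W (s - y) \<partial>G)"
    by (simp add: integrable_W)
  also have "\<dots> = (\<integral>y. (\<integral>u. indicator {s..<t} u * Z (u - y) \<partial>lborel) \<partial>G)"
  proof (rule Bochner_Integration.integral_cong)
    fix y
    have "W (t - y) - W (s - y) = (\<integral>u. indicator {s - y..<t - y} u * Z u \<partial>lborel)"
      using assms by (intro W_diff) simp
    also have "\<dots> = (\<integral>u. indicator {s - y..<t - y} (- y + 1 * u) * Z (- y + 1 * u) \<partial>lborel)"
      by (subst lborel_integral_real_affine[of 1 _ "- y"]) simp_all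
    also have "\<dots> = (\<integral>u. indicator {s..<t} u * Z (u - y) \<partial>lborel)"
      by (intro Bochner_Integration.integral_cong) (auto simp: indicator_def)
    finally show "W (t - y) - W (s - y) = (\<integral>u. indicator {s..<t} u * Z (u - y) \<partial>lborel)" .
  qed simp
  also have "\<dots> = (\<integral>u. (\<integral>y. indicator {s..<t} u * Z (u - y) \<partial>G) \<partial>lborel)"
  proof (rule P.Fubini_integral[symmetric])
    show "integrable (G \<Otimes>\<^sub>M lborel) (\<lambda>(y, u). indicator {s..<t} u * Z (u - y))"
    proof (rule integrableI_bounded_set[where A = "UNIV \<times> {s..<t}" and B = C])
      show "UNIV \<times> {s..<t} \<in> sets (G \<Otimes>\<^sub>M lborel)" by (intro pair_measureI) auto
      have "emeasure (G \<Otimes>\<^sub>M lborel) (UNIV \<times> {s..<t}) = emeasure G UNIV * emeasure lborel {s..<t}"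
        by (intro lborel.emeasure_pair_measure_Times) auto
      then show "emeasure (G \<Otimes>\<^sub>M lborel) (UNIV \<times> {s..<t}) < \<infinity>"
        using emeasure_space_1 assms by simp
    qed (use Z_abs_le C_pos in \<open>auto simp: indicator_def split: prod.splits\<close>)
  qed
  also have "\<dots> \<le> (\<integral>u. indicator {s..<t} u * Z u \<partial>lborel)"
  proof (rule integral_mono)
    have "\<bar>\<integral>y. Z (u - y) \<partial>G\<bar> \<le> C" for u
    proof -
      have "0 \<le> (\<integral>y. Z (u - y) \<partial>G)" using Z_nonneg by simp
      then show ?thesis using superharmonic[of u] Z_le[of u] by simp
    qed
    then have "integrable lborel (\<lambda>u. indicator {s..<t} u * (\<integral>y. Z (u - y) \<partial>G))"
      by (rule integrable_indicator_atLeastLessThan[rotated]) measurable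
    then show "integrable lborel (\<lambda>u. \<integral>y. indicator {s..<t} u * Z (u - y) \<partial>G)" by simp
    show "integrable lborel (\<lambda>u. indicator {s..<t} u * Z u)"
      by (rule integrable_indicator_atLeastLessThan[OF _ Z_abs_le]) simp
  qed (use superharmonic in \<open>auto simp: indicator_def\<close>)
  also have "\<dots> = W t - W s"
    using assms by (rule W_diff[symmetric])
  finally show ?thesis by (simp add: H_def)
qed

text \<open>The function exp(\<kappa> t) is an eigenfunction of averaging against G, with eigenvalue
  below 1. One application gives decay of G*W at -oo, as \<open>H_nonneg\<close> requires; iteration
  gives \<open>I_pos\<close>.\<close>

lemma integral_W_le:
  assumes "\<And>t. W t \<le> B * exp (\<kappa> * t)"
  shows "(\<integral>y. W (t - y) \<partial>G) \<le> B * (\<integral>y. exp (- \<kappa> * y) \<partial>G) * exp (\<kappa> * t)"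
proof -
  have "(\<integral>y. W (t - y) \<partial>G) \<le> (\<integral>y. (B * exp (\<kappa> * t)) * exp (- \<kappa> * y) \<partial>G)"
  proof (rule integral_mono)
    show "integrable G (\<lambda>y. (B * exp (\<kappa> * t)) * exp (- \<kappa> * y))"
      using integrable_exp by (intro integrable_mult_right)
    show "W (t - y) \<le> (B * exp (\<kappa> * t)) * exp (- \<kappa> * y)" for y
      using assms[of "t - y"] unfolding mult.assoc mult_exp_exp by (simp add: right_diff_distrib)
  qed (rule integrable_W)
  then show ?thesis by (simp add: mult_ac)
qed

text \<open>As W is nonnegative, H is at least -G*W, which vanishes at -oo; monotonicity propagates
  the bound to every t.\<close>

lemma H_nonneg: "0 \<le> H t"
proof (rule tendsto_upperbound)
  let ?c = "C / \<kappa> * (\<integral>y. exp (- \<kappa> * y) \<partial>G)"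
  have "((\<lambda>s. ?c * exp (\<kappa> * s)) \<longlongrightarrow> ?c * 0) at_bot"
    using \<kappa>_pos by (intro tendsto_mult_left) real_asymp
  from tendsto_minus[OF this] show "((\<lambda>s. - (?c * exp (\<kappa> * s))) \<longlongrightarrow> 0) at_bot" by simp
  show "\<forall>\<^sub>F s in at_bot. - (?c * exp (\<kappa> * s)) \<le> H t"
    using eventually_le_at_bot[of t]
  proof eventually_elim
    case (elim s)
    have "- (?c * exp (\<kappa> * s)) \<le> H s"
      using integral_W_le[OF W_le, of s] W_nonneg[of s] by (simp add: H_def)
    then show ?case using H_mono[OF elim] by linarith
  qed
qed simp

text \<open>H is a G-average of increments of the Lipschitz function W, so the finite first absolute
  moment of G bounds it.\<close>

lemma H_le: "H t \<le> C * (\<integral>y. \<bar>y\<bar> \<partial>G)"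
proof -
  have "H t = (\<integral>y. W t - W (t - y) \<partial>G)"
    using prob_space by (simp add: H_def integrable_W)
  also have "\<dots> \<le> (\<integral>y. C * \<bar>y\<bar> \<partial>G)"
  proof (rule integral_mono)
    show "W t - W (t - y) \<le> C * \<bar>y\<bar>" for y
      using W_Lipschitz[of t "t - y"] by simp
  qed (use integrable_id integrable_W in auto)
  finally show ?thesis by simp
qed

definition I :: real where "I = (SUP t. H t)"

lemma bdd_above_H: "bdd_above (range H)"
  using H_le by (rule bdd_aboveI2)

lemma H_le_I: "H t \<le> I"
  unfolding I_def using bdd_above_H by (rule cSUP_upper[OF UNIV_I])

lemma tendsto_H: "(H \<longlongrightarrow> I) at_top"
proof (rule increasing_tendsto)
  show "\<forall>\<^sub>F t in at_top. H t \<le> I" using H_le_I by simp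
  fix x assume "x < I"
  then obtain t where "x < H t" unfolding I_def using less_cSUP_iff[OF _ bdd_above_H] by auto
  then show "\<forall>\<^sub>F t in at_top. x < H t"
    unfolding eventually_at_top_linorder using H_mono less_le_trans by blast
qed

text \<open>Over a distance \<delta> to the right Z gains at most the factor exp(\<theta> \<delta>),
  so a large value at x forces large values just to its left. Left increments of W therefore bound Z
  x from above, and right increments (\<open>W_increment_le\<close>) bound it from below. This is
  the Tauberian step back from W to Z.\<close>

lemma W_increment_ge:
  assumes "0 \<le> \<delta>"
  shows "\<delta> * (exp (- \<theta> * \<delta>) * Z x) \<le> W x - W (x - \<delta>)"
proof -
  have "(x - (x - \<delta>)) * (exp (- \<theta> * \<delta>) * Z x) \<le> W x - W (x - \<delta>)"
  proof (rule W_diff_ge)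
    fix u assume u: "x - \<delta> \<le> u" "u < x"
    have "exp (- \<theta> * \<delta>) * Z x \<le> exp (- \<theta> * \<delta>) * (exp (\<theta> * (x - u)) * Z u)"
      using u by (intro mult_left_mono Z_mono) auto
    also have "\<dots> = exp (\<theta> * (x - u - \<delta>)) * Z u"
      unfolding mult.assoc[symmetric] mult_exp_exp by (simp add: right_diff_distrib)
    also have "\<dots> \<le> 1 * Z u"
      using u \<theta>_nonneg Z_nonneg by (intro mult_right_mono) (auto simp: mult_nonneg_nonpos)
    finally show "exp (- \<theta> * \<delta>) * Z x \<le> Z u" by simp
  qed (use assms in auto)
  then show ?thesis by simp
qed

lemma W_increment_le:
  assumes "0 \<le> \<delta>"
  shows "W (x + \<delta>) - W x \<le> \<delta> * (exp (\<theta> * \<delta>) * Z x)"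
proof -
  have "W (x + \<delta>) - W x \<le> (x + \<delta> - x) * (exp (\<theta> * \<delta>) * Z x)"
  proof (rule W_diff_le)
    fix u assume u: "x \<le> u" "u < x + \<delta>"
    have "Z u \<le> exp (\<theta> * (u - x)) * Z x" using u by (intro Z_mono) auto
    also have "\<dots> \<le> exp (\<theta> * \<delta>) * Z x"
      using u \<theta>_nonneg Z_nonneg by (intro mult_right_mono) (auto simp: mult_left_mono)
    finally show "Z u \<le> exp (\<theta> * \<delta>) * Z x" .
  qed (use assms in auto)
  then show ?thesis by simp
qed

text \<open>If I were 0, H would vanish and W would be harmonic for G. Feeding the bound of W into
  the harmonic equation repeatedly shrinks it geometrically, so W would be 0, although Z is positive
  somewhere and hence also just to the left of that point.\<close>

lemma I_pos: "0 < I"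
proof (rule ccontr)
  assume "\<not> 0 < I"
  then have H0: "H t = 0" for t using H_nonneg[of t] H_le_I[of t] by linarith
  have harm: "W t = (\<integral>y. W (t - y) \<partial>G)" for t using H0[of t] unfolding H_def by linarith
  define \<rho> where "\<rho> = (\<integral>y. exp (- \<kappa> * y) \<partial>G)"
  have \<rho>: "0 \<le> \<rho>" "\<rho> < 1" using exp_less_1 by (auto simp: \<rho>_def)
  have bnd: "W t \<le> C / \<kappa> * \<rho> ^ n * exp (\<kappa> * t)" for n t
  proof (induction n arbitrary: t)
    case 0
    show ?case using W_le[of t] by simp
  next
    case (Suc n)
    show ?case using integral_W_le[OF Suc.IH, of t] harm[of t] by (simp add: \<rho>_def mult_ac)
  qed
  have "W t \<le> 0" for t
  proof (rule tendsto_lowerbound)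
    have "(\<lambda>n. C / \<kappa> * \<rho> ^ n * exp (\<kappa> * t)) \<longlonglongrightarrow> C / \<kappa> * 0 * exp (\<kappa> * t)"
      using \<rho> by (intro tendsto_intros LIMSEQ_power_zero) auto
    then show "(\<lambda>n. C / \<kappa> * \<rho> ^ n * exp (\<kappa> * t)) \<longlonglongrightarrow> 0" by simp
  qed (use bnd in auto)
  then have W0: "W t = 0" for t using W_nonneg[of t] by (simp add: antisym)
  obtain x where "0 < Z x" using Z_pos by blast
  then have "0 < exp (- \<theta> * 1) * Z x" by simp
  then show False using W_increment_ge[of 1 x] by (simp add: W0)
qed

text \<open>Compactness yields only subsequences, but the limit found does not depend on the
  sequence chosen, so \<open>tendsto_at_top_subsequenceI\<close> upgrades this to convergence at
  infinity.\<close>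

lemma increment_subsequence:
  assumes x: "filterlim x at_top sequentially"
  shows "\<exists>r. strict_mono (r :: nat \<Rightarrow> nat) \<and>
    (\<lambda>n. W (x (r n) + a) - W (x (r n))) \<longlonglongrightarrow> a * (I / (\<integral>y. y \<partial>G))"
proof -
  have lip: "\<bar>(W (x n + a) - W (x n)) - (W (x n + b) - W (x n))\<bar> \<le> C * \<bar>a - b\<bar>" for n a b
    using W_Lipschitz[of "x n + a" "x n + b"] by simp
  obtain r D where r: "strict_mono (r :: nat \<Rightarrow> nat)"
    and D: "\<And>a. (\<lambda>n. W (x (r n) + a) - W (x (r n))) \<longlonglongrightarrow> D a"
    by (rule Lipschitz_sequence_convergent_subsequence[where f = "\<lambda>n a. W (x n + a) - W (x n)", OF lip]) auto
  have D_lip: "\<bar>D a - D b\<bar> \<le> C * \<bar>a - b\<bar>" for a b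
  proof (rule tendsto_upperbound)
    show "(\<lambda>n. \<bar>(W (x (r n) + a) - W (x (r n))) - (W (x (r n) + b) - W (x (r n)))\<bar>) \<longlonglongrightarrow> \<bar>D a - D b\<bar>"
      by (intro tendsto_intros D)
  qed (use lip in auto)
  have D_0: "D 0 = 0" using D[of 0] by (simp add: LIMSEQ_const_iff)
  have D_cont: "continuous_on UNIV D" by (rule continuous_on_Lipschitz_real) (rule D_lip)
  then have [measurable]: "D \<in> borel_measurable borel" by (rule borel_measurable_continuous_onI)
  have D_bound: "\<bar>D (a - y)\<bar> \<le> C * \<bar>a\<bar> + C * \<bar>y\<bar>" for a y
  proof -
    have "\<bar>D (a - y)\<bar> \<le> C * \<bar>a - y\<bar>" using D_lip[of "a - y" 0] D_0 by simp
    also have "\<dots> \<le> C * (\<bar>a\<bar> + \<bar>y\<bar>)" using C_pos by (intro mult_left_mono) auto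
    finally show ?thesis by (simp add: distrib_left)
  qed
  have int_D: "integrable G (\<lambda>y. D (a - y))" for a
    by (rule integrable_affine_bound) (use D_bound in auto)
  have xr: "filterlim (\<lambda>n. x (r n) + a) at_top sequentially" for a
    using filterlim_compose[OF x filterlim_subseq[OF r]] by (subst add.commute) (rule filterlim_tendsto_add_at_top[OF tendsto_const])
  \<comment> \<open>This is the limit of W = H + G*W at \<open>x (r n) + a\<close>, after
    subtracting \<open>W (x (r n))\<close>. The Lipschitz bound and the first moment of G provide
    the dominating function.\<close>
  have D_eq: "D a = I + (\<integral>y. D (a - y) \<partial>G)" for a
  proof (rule LIMSEQ_unique[OF D])
    have "(\<lambda>n. H (x (r n) + a) + (\<integral>y. W (x (r n) + (a - y)) - W (x (r n)) \<partial>G)) \<longlonglongrightarrow> I + (\<integral>y. D (a - y) \<partial>G)"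
    proof (intro tendsto_add filterlim_compose[OF tendsto_H xr])
      show "(\<lambda>n. \<integral>y. W (x (r n) + (a - y)) - W (x (r n)) \<partial>G) \<longlonglongrightarrow> (\<integral>y. D (a - y) \<partial>G)"
      proof (rule integral_dominated_convergence)
        show "integrable G (\<lambda>y. C * \<bar>a\<bar> + C * \<bar>y\<bar>)" using integrable_id by simp
        show "AE y in G. norm (W (x (r n) + (a - y)) - W (x (r n))) \<le> C * \<bar>a\<bar> + C * \<bar>y\<bar>" for n
        proof (intro always_eventually allI)
          fix y
          have "\<bar>W (x (r n) + (a - y)) - W (x (r n))\<bar> \<le> C * \<bar>a - y\<bar>"
            using lip[of "r n" "a - y" 0] by simp
          also have "\<dots> \<le> C * (\<bar>a\<bar> + \<bar>y\<bar>)" using C_pos by (intro mult_left_mono) auto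
          finally show "norm (W (x (r n) + (a - y)) - W (x (r n))) \<le> C * \<bar>a\<bar> + C * \<bar>y\<bar>"
            by (simp add: distrib_left)
        qed
      qed (use D in auto)
    qed
    moreover have "H (x (r n) + a) + (\<integral>y. W (x (r n) + (a - y)) - W (x (r n)) \<partial>G) = W (x (r n) + a) - W (x (r n))" for n
      using integrable_W[of "x (r n) + a"] prob_space by (simp add: H_def algebra_simps)
    ultimately show "(\<lambda>n. W (x (r n) + a) - W (x (r n))) \<longlonglongrightarrow> I + (\<integral>y. D (a - y) \<partial>G)" by simp
  qed
  have D_add: "D (b + a) = D b + D a" for a b
  proof -
    define \<zeta> where "\<zeta> t = D (t + a) - D t" for t
    have \<zeta>_cont: "continuous_on UNIV \<zeta>"
      unfolding \<zeta>_def by (intro continuous_intros continuous_on_compose2[OF D_cont]) auto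
    define P where "P = {y. \<forall>t. \<zeta> (t - y) = \<zeta> t}"
    have AE_P: "AE y in G. y \<in> P"
      unfolding P_def mem_Collect_eq
    proof (rule bounded_harmonic_AE_period[OF \<zeta>_cont])
      show "\<bar>\<zeta> t\<bar> \<le> C * \<bar>a\<bar>" for t using D_lip[of "t + a" t] by (simp add: \<zeta>_def)
      show "\<zeta> t = (\<integral>y. \<zeta> (t - y) \<partial>G)" for t
        using int_D[of "t + a"] int_D[of t] D_eq[of "t + a"] D_eq[of t]
        by (simp add: \<zeta>_def algebra_simps)
    qed
    have "P = UNIV"
    proof (rule period_eq_UNIV[OF _ _ _ AE_P])
      have "P = (\<Inter>t. {y. \<zeta> (t - y) = \<zeta> t})" by (auto simp: P_def)
      moreover have "closed {y. \<zeta> (t - y) = \<zeta> t}" for t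
        by (intro closed_Collect_eq continuous_on_compose2[OF \<zeta>_cont] continuous_intros) auto
      ultimately show "closed P" by auto
      show "x - y \<in> P" if "x \<in> P" "y \<in> P" for x y
        using that unfolding P_def mem_Collect_eq
        by (metis (no_types, opaque_lifting) add_diff_cancel diff_add_eq diff_diff_eq2)
    qed (simp add: P_def)
    \<comment> \<open>With b as a period, the increment of D starting at b equals the one starting
      at 0; this is additivity because D 0 = 0.\<close>
    then have "b \<in> P" by simp
    then have "\<zeta> (b - b) = \<zeta> b" unfolding P_def by blast
    then show ?thesis by (simp add: \<zeta>_def D_0)
  qed
  have D_lin: "D a = a * D 1" for a
    by (rule additive_Lipschitz_linear[OF D_add]) (use D_lip[of _ 0] D_0 in auto)
  \<comment> \<open>The equation for D at a = 0 fixes the slope: the average of the linear D at -y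
    is minus the slope times the mean of G.\<close>
  have "0 = I + (\<integral>y. (0 - y) * D 1 \<partial>G)"
    using D_eq[of 0] by (subst (asm) (2) D_lin) (simp add: D_0)
  then have "D 1 = I / (\<integral>y. y \<partial>G)" using mean_pos by (simp add: field_simps)
  then show ?thesis using r D[of a] D_lin[of a] by auto
qed

lemma tendsto_increment: "((\<lambda>x. W (x + a) - W x) \<longlongrightarrow> a * (I / (\<integral>y. y \<partial>G))) at_top"
  by (rule tendsto_at_top_subsequenceI) (rule increment_subsequence)

theorem tendsto_Z: "(Z \<longlongrightarrow> I / (\<integral>y. y \<partial>G)) at_top"
proof (rule order_tendstoI)
  let ?L = "I / (\<integral>y. y \<partial>G)"
  \<comment> \<open>Two limits are taken in order: x to infinity at a fixed window width \<delta>,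
    then \<delta> to 0. The window to the right of x gives the lower bound, the window to the left
    (increment \<open>- \<delta>\<close>) the upper one.\<close>
  have ev: "\<forall>\<^sub>F x in at_top. exp (- \<theta> * \<delta>) * (?L - \<delta>) \<le> Z x \<and> Z x \<le> exp (\<theta> * \<delta>) * (?L + \<delta>)"
    if "\<delta> > 0" for \<delta>
  proof -
    have lim: "((\<lambda>x. (W (x + a) - W x) / a) \<longlongrightarrow> ?L) at_top" if "a \<noteq> 0" for a
      using tendsto_divide[OF tendsto_increment[of a] tendsto_const[of a]] that by simp
    have "\<forall>\<^sub>F x in at_top. ?L - \<delta> < (W (x + \<delta>) - W x) / \<delta>"
      "\<forall>\<^sub>F x in at_top. (W (x + (- \<delta>)) - W x) / (- \<delta>) < ?L + \<delta>"
      using \<open>\<delta> > 0\<close> by (intro order_tendstoD[OF lim]; simp)+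
    then show ?thesis
    proof eventually_elim
      case (elim x)
      have "exp (- \<theta> * \<delta>) * (?L - \<delta>) \<le> exp (- \<theta> * \<delta>) * ((W (x + \<delta>) - W x) / \<delta>)"
        using elim(1) by (intro mult_left_mono) auto
      also have "\<dots> \<le> exp (- \<theta> * \<delta>) * (exp (\<theta> * \<delta>) * Z x)"
        using W_increment_le[of \<delta> x] \<open>\<delta> > 0\<close> by (intro mult_left_mono) (auto simp: field_simps)
      also have "\<dots> = Z x" unfolding mult.assoc[symmetric] mult_exp_exp by simp
      finally have 1: "exp (- \<theta> * \<delta>) * (?L - \<delta>) \<le> Z x" .
      have "Z x = exp (\<theta> * \<delta>) * (exp (- \<theta> * \<delta>) * Z x)"
        unfolding mult.assoc[symmetric] mult_exp_exp by simp
      also have "\<dots> \<le> exp (\<theta> * \<delta>) * ((W x - W (x - \<delta>)) / \<delta>)"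
        using W_increment_ge[of \<delta> x] \<open>\<delta> > 0\<close> by (intro mult_left_mono) (auto simp: field_simps)
      also have "\<dots> \<le> exp (\<theta> * \<delta>) * (?L + \<delta>)"
        using elim(2) \<open>\<delta> > 0\<close> by (intro mult_left_mono) (auto simp: field_simps)
      finally show ?case using 1 by blast
    qed
  qed
  {
    fix a assume "a < ?L"
    have "((\<lambda>\<delta>. exp (- \<theta> * \<delta>) * (?L - \<delta>)) \<longlongrightarrow> exp (- \<theta> * 0) * (?L - 0)) (at_right 0)"
      by (intro tendsto_intros)
    then have "\<forall>\<^sub>F \<delta> in at_right 0. a < exp (- \<theta> * \<delta>) * (?L - \<delta>)"
      using \<open>a < ?L\<close> by (intro order_tendstoD) auto
    with eventually_at_right_less[of 0] have "\<forall>\<^sub>F \<delta> in at_right 0. 0 < \<delta> \<and> a < exp (- \<theta> * \<delta>) * (?L - \<delta>)"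
      by eventually_elim simp
    then obtain \<delta> where \<delta>: "0 < \<delta>" "a < exp (- \<theta> * \<delta>) * (?L - \<delta>)"
      using eventually_happens'[OF trivial_limit_at_right_real] by blast
    from ev[OF \<delta>(1)] show "\<forall>\<^sub>F x in at_top. a < Z x"
      by eventually_elim (use \<delta>(2) in linarith)
  next
    fix a assume "?L < a"
    have "((\<lambda>\<delta>. exp (\<theta> * \<delta>) * (?L + \<delta>)) \<longlongrightarrow> exp (\<theta> * 0) * (?L + 0)) (at_right 0)"
      by (intro tendsto_intros)
    then have "\<forall>\<^sub>F \<delta> in at_right 0. exp (\<theta> * \<delta>) * (?L + \<delta>) < a"
      using \<open>?L < a\<close> by (intro order_tendstoD) auto
    with eventually_at_right_less[of 0] have "\<forall>\<^sub>F \<delta> in at_right 0. 0 < \<delta> \<and> exp (\<theta> * \<delta>) * (?L + \<delta>) < a"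
      by eventually_elim simp
    then obtain \<delta> where \<delta>: "0 < \<delta>" "exp (\<theta> * \<delta>) * (?L + \<delta>) < a"
      using eventually_happens'[OF trivial_limit_at_right_real] by blast
    from ev[OF \<delta>(1)] show "\<forall>\<^sub>F x in at_top. Z x < a"
      by eventually_elim (use \<delta>(2) in linarith)
  }
qed

end

section \<open>Tail bounds for the perturbed walk\<close>

lemma exp_gt_add_one:
  fixes z :: real assumes "z \<noteq> 0"
  shows "1 + z < exp z"
proof (cases "0 \<le> 1 + z / 2")
  case True
  \<comment> \<open>Squaring the weak inequality at z / 2 gains the strictly positive term z^2 /
    4.\<close>
  have "0 < z\<^sup>2" using assms by simp
  then have "1 + z < (1 + z / 2)\<^sup>2" by (simp add: power2_eq_square algebra_simps)
  also have "\<dots> \<le> (exp (z / 2))\<^sup>2" using True exp_ge_add_one_self[of "z / 2"] by (intro power_mono) auto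
  also have "\<dots> = exp z" by (simp add: exp_double[symmetric])
  finally show ?thesis .
next
  case False
  then show ?thesis using exp_gt_zero[of z] by linarith
qed

text \<open>The strict tangent bounds at t u, evaluated at u and at 0, are added with weights t and
  1 - t; the linear terms cancel.\<close>

lemma exp_strict_convex_zero:
  fixes u t :: real assumes "u \<noteq> 0" "0 < t" "t < 1"
  shows "exp (t * u) < 1 + t * (exp u - 1)"
proof -
  have "t * (exp (t * u) * (1 + (1 - t) * u)) < t * (exp (t * u) * exp ((1 - t) * u))"
    using assms by (intro mult_strict_left_mono exp_gt_add_one) auto
  moreover have "(1 - t) * (exp (t * u) * (1 + (- t * u))) < (1 - t) * (exp (t * u) * exp (- t * u))"
    using assms by (intro mult_strict_left_mono exp_gt_add_one) auto
  ultimately show ?thesis unfolding mult_exp_exp by (simp add: algebra_simps)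
qed

lemma exp_minus_one_less:
  fixes u :: real assumes "u \<noteq> 0"
  shows "exp u - 1 < u * exp u"
proof -
  have "exp u * (1 + (- u)) < exp u * exp (- u)"
    using assms by (intro mult_strict_left_mono exp_gt_add_one) auto
  then show ?thesis unfolding mult_exp_exp by (simp add: algebra_simps)
qed

lemma (in prob_space) integral_pos_of_nontrivial:
  fixes f g :: "'a \<Rightarrow> real"
  assumes "integrable M g" "\<And>x. f x \<noteq> 0 \<Longrightarrow> 0 < g x" "\<And>x. f x = 0 \<Longrightarrow> g x = 0"
    and "\<not> (AE x in M. f x = 0)"
  shows "0 < expectation g"
proof (rule ccontr)
  have nonneg: "0 \<le> g x" for x using assms(2,3)[of x] by (cases "f x = 0") auto
  assume "\<not> 0 < expectation g"
  moreover have "0 \<le> expectation g" using nonneg by simp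
  ultimately have "expectation g = 0" by simp
  then have "AE x in M. g x = 0"
    using integral_nonneg_eq_0_iff_AE[OF assms(1)] nonneg by simp
  then have "AE x in M. f x = 0" by eventually_elim (use assms(2) in force)
  with assms(4) show False by simp
qed

text \<open>The moment generating function is strictly convex and takes the value 1 at 0 and
  \<theta>, so it is smaller in between and has a positive derivative at \<theta>. Each claim
  integrates a pointwise inequality that is strict off 0, and the law is not concentrated at
  0.\<close>

lemma (in real_distribution) Lundberg_exponent:
  assumes nontriv: "\<not> (AE y in M. y = 0)" and "0 < \<theta>"
    and int: "integrable M (\<lambda>y. exp (\<theta> * y))" and one: "(\<integral>y. exp (\<theta> * y) \<partial>M) = 1"
  shows "0 < \<eta> \<Longrightarrow> \<eta> < \<theta> \<Longrightarrow> integrable M (\<lambda>y. exp (\<eta> * y)) \<Longrightarrow> (\<integral>y. exp (\<eta> * y) \<partial>M) < 1"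
    and "integrable M (\<lambda>y. y * exp (\<theta> * y)) \<Longrightarrow> 0 < (\<integral>y. y * exp (\<theta> * y) \<partial>M)"
proof -
  assume \<eta>: "0 < \<eta>" "\<eta> < \<theta>" and int': "integrable M (\<lambda>y. exp (\<eta> * y))"
  let ?t = "\<eta> / \<theta>"
  have "0 < (\<integral>y. 1 + ?t * (exp (\<theta> * y) - 1) - exp (\<eta> * y) \<partial>M)"
  proof (rule integral_pos_of_nontrivial[where f = "\<lambda>y. y"])
    show "0 < 1 + ?t * (exp (\<theta> * y) - 1) - exp (\<eta> * y)" if "y \<noteq> 0" for y
      using exp_strict_convex_zero[of "\<theta> * y" ?t] \<eta> that by simp
  qed (use nontriv int int' in auto)
  then show "(\<integral>y. exp (\<eta> * y) \<partial>M) < 1"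
    using int int' one prob_space by simp
next
  assume int': "integrable M (\<lambda>y. y * exp (\<theta> * y))"
  have "0 < (\<integral>y. \<theta> * (y * exp (\<theta> * y)) - (exp (\<theta> * y) - 1) \<partial>M)"
  proof (rule integral_pos_of_nontrivial[where f = "\<lambda>y. y"])
    show "0 < \<theta> * (y * exp (\<theta> * y)) - (exp (\<theta> * y) - 1)" if "y \<noteq> 0" for y
      using exp_minus_one_less[of "\<theta> * y"] \<open>0 < \<theta>\<close> that by simp
  qed (use nontriv int int' in auto)
  then have "0 < \<theta> * (\<integral>y. y * exp (\<theta> * y) \<partial>M)"
    using int int' one prob_space by simp
  then show "0 < (\<integral>y. y * exp (\<theta> * y) \<partial>M)"
    using \<open>0 < \<theta>\<close> by (simp add: zero_less_mult_iff)
qed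

text \<open>Steps and perturbations are realized as coordinates on a product space: splitting off
  the first step becomes \<open>case_nat\<close>, and stationarity becomes invariance of \<Xi> under
  the one-step shift.\<close>

locale perturbed_walk = real_distribution F for F :: "real measure" +
  fixes \<Xi> :: "(nat \<Rightarrow> real) measure"
  assumes prob_\<Xi>: "prob_space \<Xi>"
    and sets_\<Xi>[measurable_cong, simp]: "sets \<Xi> = sets (\<Pi>\<^sub>M j\<in>UNIV. borel)"
    and shift: "distr \<Xi> (\<Pi>\<^sub>M j\<in>UNIV. borel) (\<lambda>e j. e (Suc j)) = \<Xi>"
begin

abbreviation S :: "(nat \<Rightarrow> real) measure" where "S \<equiv> \<Pi>\<^sub>M j\<in>UNIV. F"

sublocale seq: sequence_space F
  by (intro sequence_space.intro product_prob_space.intro product_sigma_finite.intro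
      product_prob_space_axioms.intro) (rule sigma_finite_measure_axioms prob_space_axioms)+

sublocale \<Xi>: prob_space \<Xi> by (rule prob_\<Xi>)

sublocale Q: pair_prob_space S \<Xi>
  by (intro pair_prob_space.intro pair_sigma_finite.intro seq.P.sigma_finite_measure_axioms
      \<Xi>.sigma_finite_measure_axioms seq.P.prob_space_axioms \<Xi>.prob_space_axioms)

section \<open>The canonical space and bounds for the renewal function\<close>

lemma space_S[simp]: "space S = UNIV"
  by (simp add: space_PiM)

lemma space_\<Xi>[simp]: "space \<Xi> = UNIV"
  using sets_eq_imp_space_eq[OF sets_\<Xi>] by (simp add: space_PiM)

lemma sets_S[measurable_cong]: "sets S = sets (\<Pi>\<^sub>M j\<in>UNIV. borel)"
  by (intro sets_PiM_cong) auto

text \<open>Putting an independent draw from F in front of an i.i.d. sequence reproduces its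
  law.\<close>

lemma emeasure_S_first_step:
  assumes "Measurable.pred S P"
  shows "emeasure S {w. P w} = (\<integral>\<^sup>+z. emeasure S {w. P (case_nat z w)} \<partial>F)"
proof -
  note [measurable] = assms
  have meas: "{w \<in> space S. P w} \<in> sets S"
    "{p \<in> space (F \<Otimes>\<^sub>M S). P (case_nat (fst p) (snd p))} \<in> sets (F \<Otimes>\<^sub>M S)"
    by measurable
  have "emeasure S {w. P w} = emeasure (distr (F \<Otimes>\<^sub>M S) S (\<lambda>(s, \<omega>). case_nat s \<omega>)) {w \<in> space S. P w}"
    by (simp add: seq.PiM_iter)
  also have "\<dots> = emeasure (F \<Otimes>\<^sub>M S) {p \<in> space (F \<Otimes>\<^sub>M S). P (case_nat (fst p) (snd p))}"
    using meas(1) by (subst emeasure_distr) (auto simp: space_pair_measure intro!: arg_cong2[where f = emeasure])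
  also have "\<dots> = (\<integral>\<^sup>+z. emeasure S {w. P (case_nat z w)} \<partial>F)"
    using meas(2) by (subst seq.P.emeasure_pair_measure_alt) (auto simp: space_pair_measure vimage_def)
  finally show ?thesis .
qed

lemma component_measurable[measurable]: "(\<lambda>e. e k) \<in> borel_measurable \<Xi>"
  unfolding measurable_cong_sets[OF sets_\<Xi> refl] by measurable

lemma shift_measurable[measurable]: "(\<lambda>e j. e (Suc j)) \<in> \<Xi> \<rightarrow>\<^sub>M (\<Pi>\<^sub>M j\<in>UNIV. borel)"
  by (rule measurable_PiM_single') auto

lemma nn_integral_shift:
  assumes "f \<in> borel_measurable \<Xi>"
  shows "(\<integral>\<^sup>+e. f (\<lambda>j. e (Suc j)) \<partial>\<Xi>) = (\<integral>\<^sup>+e. f e \<partial>\<Xi>)"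
proof -
  have "(\<integral>\<^sup>+e. f e \<partial>\<Xi>) = (\<integral>\<^sup>+e. f e \<partial>distr \<Xi> (\<Pi>\<^sub>M j\<in>UNIV. borel) (\<lambda>e j. e (Suc j)))"
    by (simp add: shift)
  also have "\<dots> = (\<integral>\<^sup>+e. f (\<lambda>j. e (Suc j)) \<partial>\<Xi>)"
    using assms unfolding measurable_cong_sets[OF sets_\<Xi> refl] by (intro nn_integral_distr) simp_all
  finally show ?thesis ..
qed

lemma nn_integral_component:
  assumes [measurable]: "f \<in> borel_measurable borel"
  shows "(\<integral>\<^sup>+e. f (e k) \<partial>\<Xi>) = (\<integral>\<^sup>+e. f (e 0) \<partial>\<Xi>)"
proof (induction k)
  case (Suc k)
  show ?case using nn_integral_shift[of "\<lambda>e. f (e k)"] Suc by simp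
qed simp

text \<open>Summed over k < n this is a truncated renewal function: the expected number of times k <
  n at which the unperturbed walk is above y.\<close>

definition p :: "nat \<Rightarrow> real \<Rightarrow> ennreal" where
  "p k y = emeasure S {w. (\<Sum>j<k. w j) > y}"

lemma p_0: "p 0 y = indicator {..<0} y"
  using seq.P.emeasure_space_1 by (auto simp: p_def indicator_def)

lemma p_Suc: "p (Suc k) y = (\<integral>\<^sup>+z. p k (y - z) \<partial>F)"
proof -
  have "p (Suc k) y = (\<integral>\<^sup>+z. emeasure S {w. (\<Sum>j<Suc k. case_nat z w j) > y} \<partial>F)"
    unfolding p_def by (rule emeasure_S_first_step) measurable
  also have "\<dots> = (\<integral>\<^sup>+z. p k (y - z) \<partial>F)"
    by (intro nn_integral_cong) (simp add: p_def sum.lessThan_Suc_shift less_diff_eq diff_less_eq add.commute del: sum.lessThan_Suc)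
  finally show ?thesis .
qed

lemma p_measurable[measurable]: "p k \<in> borel_measurable borel"
proof (induction k)
  case 0
  show ?case by (simp add: p_0[abs_def])
next
  case (Suc k)
  note [measurable] = Suc
  show ?case unfolding p_Suc[abs_def] by measurable
qed

lemma nn_integral_exp:
  assumes "integrable N (\<lambda>y. exp (\<eta> * f y))" "0 \<le> K"
  shows "(\<integral>\<^sup>+z. ennreal (K * exp (- \<eta> * (y - f z))) \<partial>N) = ennreal (K * (\<integral>y. exp (\<eta> * f y) \<partial>N) * exp (- \<eta> * y))"
proof -
  have eq: "K * exp (- \<eta> * (y - f z)) = K * exp (- \<eta> * y) * exp (\<eta> * f z)" for z
    unfolding mult.assoc mult_exp_exp by (simp add: algebra_simps)
  have "(\<integral>\<^sup>+z. ennreal (K * exp (- \<eta> * (y - f z))) \<partial>N) = ennreal (\<integral>z. K * exp (- \<eta> * y) * exp (\<eta> * f z) \<partial>N)"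
    unfolding eq using assms by (intro nn_integral_eq_integral) auto
  then show ?thesis by (simp add: mult_ac)
qed

text \<open>The Chernoff bound, proved through the first-step recursion \<open>p_Suc\<close>; at k =
  0 it compares the indicator of y < 0 with an exponential that is at least 1 there.\<close>

lemma p_le:
  assumes "0 < \<eta>" "integrable F (\<lambda>y. exp (\<eta> * y))"
  shows "p k y \<le> ennreal ((\<integral>y. exp (\<eta> * y) \<partial>F) ^ k * exp (- \<eta> * y))"
proof (induction k arbitrary: y)
  case 0
  show ?case using \<open>0 < \<eta>\<close> by (auto simp: p_0 indicator_def mult_nonneg_nonpos less_imp_le ennreal_leI simp flip: ennreal_1)
next
  case (Suc k)
  have "p (Suc k) y \<le> (\<integral>\<^sup>+z. ennreal ((\<integral>y. exp (\<eta> * y) \<partial>F) ^ k * exp (- \<eta> * (y - z))) \<partial>F)"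
    unfolding p_Suc by (intro nn_integral_mono Suc)
  also have "\<dots> = ennreal ((\<integral>y. exp (\<eta> * y) \<partial>F) ^ Suc k * exp (- \<eta> * y))"
    using nn_integral_exp[OF assms(2), of "(\<integral>y. exp (\<eta> * y) \<partial>F) ^ k" y] unfolding power_Suc2 by simp
  finally show ?case .
qed

lemma sum_p_le:
  assumes "0 < \<eta>" "integrable F (\<lambda>y. exp (\<eta> * y))" "(\<integral>y. exp (\<eta> * y) \<partial>F) < 1"
  shows "(\<Sum>k<n. p k y) \<le> ennreal (1 / (1 - (\<integral>y. exp (\<eta> * y) \<partial>F)) * exp (- \<eta> * y))"
proof -
  define \<rho> where "\<rho> = (\<integral>y. exp (\<eta> * y) \<partial>F)"
  have \<rho>: "0 \<le> \<rho>" "\<rho> < 1" using assms by (auto simp: \<rho>_def)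
  have "(\<Sum>k<n. p k y) \<le> (\<Sum>k<n. ennreal (\<rho> ^ k * exp (- \<eta> * y)))"
    unfolding \<rho>_def by (intro sum_mono p_le assms)
  also have "\<dots> = ennreal ((\<Sum>k<n. \<rho> ^ k) * exp (- \<eta> * y))"
    using \<rho> by (subst sum_ennreal) (auto simp: sum_distrib_right)
  also have "\<dots> \<le> ennreal (1 / (1 - \<rho>) * exp (- \<eta> * y))"
    using \<rho> sum_le_suminf[of "\<lambda>k. \<rho> ^ k" "{..<n}"]
    by (intro ennreal_leI mult_right_mono) (auto simp: suminf_geometric summable_geometric)
  finally show ?thesis by (simp add: \<rho>_def)
qed

text \<open>A maximum principle: below level 0 the tilted renewal function is dominated by the
  bound at the smaller exponent, and above level 0 it is an average of its own values.\<close>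

lemma sum_p_le_critical:
  assumes "0 < \<eta>" "\<eta> < \<theta>" "integrable F (\<lambda>y. exp (\<eta> * y))" "(\<integral>y. exp (\<eta> * y) \<partial>F) < 1"
    and "integrable F (\<lambda>y. exp (\<theta> * y))" "(\<integral>y. exp (\<theta> * y) \<partial>F) = 1"
  shows "(\<Sum>k<n. p k y) \<le> ennreal (1 / (1 - (\<integral>y. exp (\<eta> * y) \<partial>F)) * exp (- \<theta> * y))"
proof (induction n arbitrary: y)
  case (Suc n)
  let ?K = "1 / (1 - (\<integral>y. exp (\<eta> * y) \<partial>F))"
  have K: "0 \<le> ?K" using assms by simp
  show ?case
  proof (cases "y < 0")
    case True
    \<comment> \<open>On the negative half-line the larger exponent gives the weaker bound, so the
      geometric estimate at \<eta> suffices.\<close>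
    then have "\<theta> * y \<le> \<eta> * y" using assms by (intro mult_right_mono_neg) auto
    then have "?K * exp (- \<eta> * y) \<le> ?K * exp (- \<theta> * y)"
      using K by (intro mult_left_mono) auto
    then show ?thesis using order_trans[OF sum_p_le[OF assms(1,3,4)] ennreal_leI] by blast
  next
    case False
    \<comment> \<open>For y \<ge> 0 the term k = 0 vanishes, so the sum is exactly an average of the
      shorter sum. The exponential at \<theta> reproduces itself because its moment is 1, so the
      constant does not grow with n.\<close>
    have "(\<Sum>k<Suc n. p k y) = (\<Sum>k<n. \<integral>\<^sup>+z. p k (y - z) \<partial>F)"
      using False by (simp add: sum.lessThan_Suc_shift p_0 p_Suc del: sum.lessThan_Suc)
    also have "\<dots> = (\<integral>\<^sup>+z. (\<Sum>k<n. p k (y - z)) \<partial>F)"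
      by (rule nn_integral_sum[symmetric]) (rule measurable_finite_borel, measurable)
    also have "\<dots> \<le> (\<integral>\<^sup>+z. ennreal (?K * exp (- \<theta> * (y - z))) \<partial>F)"
      by (intro nn_integral_mono Suc.IH)
    also have "\<dots> = ennreal (?K * exp (- \<theta> * y))"
      using nn_integral_exp[OF assms(5) K, of y] assms(6) by simp
    finally show ?thesis .
  qed
qed simp

section \<open>The tail of the perturbed maximum\<close>

definition R :: "real \<Rightarrow> real" where
  "R x = measure (S \<Otimes>\<^sub>M \<Xi>) {q. \<exists>k. (\<Sum>j<k. fst q j) + snd q k > x}"

lemma space_Q[simp]: "space (S \<Otimes>\<^sub>M \<Xi>) = UNIV"
  by (simp add: space_pair_measure)

lemma pred_R[measurable]: "Measurable.pred (S \<Otimes>\<^sub>M \<Xi>) (\<lambda>q. \<exists>k. (\<Sum>j<k. fst q j) + snd q k > x)"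
  by measurable

lemma ennreal_R: "ennreal (R x) = emeasure (S \<Otimes>\<^sub>M \<Xi>) {q. \<exists>k. (\<Sum>j<k. fst q j) + snd q k > x}"
  by (simp add: R_def Q.P.emeasure_eq_measure)

lemma emeasure_Q_alt:
  assumes [measurable]: "Measurable.pred (S \<Otimes>\<^sub>M \<Xi>) P"
  shows "emeasure (S \<Otimes>\<^sub>M \<Xi>) {q. P q} = (\<integral>\<^sup>+e. emeasure S {w. P (w, e)} \<partial>\<Xi>)"
proof -
  have "{q \<in> space (S \<Otimes>\<^sub>M \<Xi>). P q} \<in> sets (S \<Otimes>\<^sub>M \<Xi>)" by measurable
  then show ?thesis by (subst Q.emeasure_pair_measure_alt2) (auto simp: vimage_def)
qed

text \<open>A union bound over k. Given the perturbations, the k-th term is p k (x - e k), and since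
  each term involves a single coordinate, stationarity lets \<open>e 0\<close> replace
  \<open>e k\<close>. The sum can then be taken inside one expectation, whatever the dependence
  among the perturbations.\<close>

lemma R_le:
  assumes bound: "\<And>n y. (\<Sum>k<n. p k y) \<le> ennreal (K * exp (- \<eta> * y))" and "0 \<le> K"
    and int: "integrable \<Xi> (\<lambda>e. exp (\<eta> * e 0))"
  shows "R x \<le> K * (\<integral>e. exp (\<eta> * e 0) \<partial>\<Xi>) * exp (- \<eta> * x)"
proof -
  have "ennreal (R x) = emeasure (S \<Otimes>\<^sub>M \<Xi>) (\<Union>k. {q \<in> space (S \<Otimes>\<^sub>M \<Xi>). (\<Sum>j<k. fst q j) + snd q k > x})"
    unfolding ennreal_R by (intro arg_cong2[where f = emeasure]) auto
  also have "\<dots> \<le> (\<Sum>k. emeasure (S \<Otimes>\<^sub>M \<Xi>) {q \<in> space (S \<Otimes>\<^sub>M \<Xi>). (\<Sum>j<k. fst q j) + snd q k > x})"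
    by (intro emeasure_subadditive_countably image_subsetI) measurable
  also have "\<dots> = (\<Sum>k. \<integral>\<^sup>+e. p k (x - e 0) \<partial>\<Xi>)"
  proof (rule suminf_cong)
    fix k
    have "emeasure (S \<Otimes>\<^sub>M \<Xi>) {q. (\<Sum>j<k. fst q j) + snd q k > x} = (\<integral>\<^sup>+e. p k (x - e k) \<partial>\<Xi>)"
      by (subst emeasure_Q_alt) (simp_all add: p_def diff_less_eq)
    then show "emeasure (S \<Otimes>\<^sub>M \<Xi>) {q \<in> space (S \<Otimes>\<^sub>M \<Xi>). (\<Sum>j<k. fst q j) + snd q k > x} = (\<integral>\<^sup>+e. p k (x - e 0) \<partial>\<Xi>)"
      using nn_integral_component[of "\<lambda>y. p k (x - y)" k] by simp
  qed
  also have "\<dots> = (\<integral>\<^sup>+e. (\<Sum>k. p k (x - e 0)) \<partial>\<Xi>)"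
    by (rule nn_integral_suminf[symmetric]) measurable
  also have "\<dots> \<le> (\<integral>\<^sup>+e. ennreal (K * exp (- \<eta> * (x - e 0))) \<partial>\<Xi>)"
    by (intro nn_integral_mono suminf_le_const summableI bound)
  also have "\<dots> = ennreal (K * (\<integral>e. exp (\<eta> * e 0) \<partial>\<Xi>) * exp (- \<eta> * x))"
    using nn_integral_exp[OF int \<open>0 \<le> K\<close>] .
  finally show ?thesis
    using \<open>0 \<le> K\<close> by (simp add: ennreal_le_iff)
qed

lemma R_antimono: "x \<le> y \<Longrightarrow> R y \<le> R x"
  unfolding R_def
proof (rule Q.P.finite_measure_mono)
  have "{q \<in> space (S \<Otimes>\<^sub>M \<Xi>). \<exists>k. (\<Sum>j<k. fst q j) + snd q k > x} \<in> sets (S \<Otimes>\<^sub>M \<Xi>)" by measurable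
  then show "{q. \<exists>k. (\<Sum>j<k. fst q j) + snd q k > x} \<in> sets (S \<Otimes>\<^sub>M \<Xi>)" by simp
qed (auto intro: le_less_trans)

lemma R_measurable[measurable]: "R \<in> borel_measurable borel"
proof -
  have "(\<lambda>x. - R x) \<in> borel_measurable borel"
    using R_antimono by (intro borel_measurable_mono monoI) simp
  then show ?thesis by (subst (asm) borel_measurable_uminus_eq)
qed

lemma R_nonneg: "0 \<le> R x" and R_le_1: "R x \<le> 1"
  by (auto simp: R_def)

lemma R_superharmonic: "(\<integral>z. R (x - z) \<partial>F) \<le> R x"
proof -
  interpret FX: pair_sigma_finite F \<Xi> ..
  let ?g = "\<lambda>z e. emeasure S {w. \<exists>k. (\<Sum>j<k. w j) + e k > x - z}"
  have [measurable]: "(\<lambda>q. ?g (fst q) (snd q)) \<in> borel_measurable (F \<Otimes>\<^sub>M \<Xi>)"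
  proof -
    have "(\<lambda>q. emeasure S {w \<in> space S. \<exists>k. (\<Sum>j<k. w j) + snd q k > x - fst q}) \<in> borel_measurable (F \<Otimes>\<^sub>M \<Xi>)"
      by measurable
    then show ?thesis by simp
  qed
  have "(\<integral>\<^sup>+z. ennreal (R (x - z)) \<partial>F) = (\<integral>\<^sup>+z. (\<integral>\<^sup>+e. ?g z e \<partial>\<Xi>) \<partial>F)"
    unfolding ennreal_R by (subst emeasure_Q_alt) simp_all
  \<comment> \<open>Shifting the perturbations preserves their law and aligns them with the walk
    after its first step: time k of the remainder is time \<open>Suc k\<close> of the whole.\<close>
  also have "\<dots> = (\<integral>\<^sup>+z. (\<integral>\<^sup>+e. ?g z (\<lambda>j. e (Suc j)) \<partial>\<Xi>) \<partial>F)"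
    by (intro nn_integral_cong nn_integral_shift[symmetric]) measurable
  also have "\<dots> = (\<integral>\<^sup>+e. (\<integral>\<^sup>+z. ?g z (\<lambda>j. e (Suc j)) \<partial>F) \<partial>\<Xi>)"
    by (rule FX.Fubini'[symmetric]) measurable
  also have "\<dots> = (\<integral>\<^sup>+e. emeasure S {w. \<exists>k. (\<Sum>j<Suc k. w j) + e (Suc k) > x} \<partial>\<Xi>)"
  proof (rule nn_integral_cong)
    fix e :: "nat \<Rightarrow> real"
    have "emeasure S {w. \<exists>k. (\<Sum>j<Suc k. w j) + e (Suc k) > x} =
        (\<integral>\<^sup>+z. emeasure S {w. \<exists>k. (\<Sum>j<Suc k. case_nat z w j) + e (Suc k) > x} \<partial>F)"
      by (rule emeasure_S_first_step) measurable
    then show "(\<integral>\<^sup>+z. ?g z (\<lambda>j. e (Suc j)) \<partial>F) = emeasure S {w. \<exists>k. (\<Sum>j<Suc k. w j) + e (Suc k) > x}"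
      by (simp add: sum.lessThan_Suc_shift diff_less_eq add_ac del: sum.lessThan_Suc)
  qed
  also have "\<dots> = emeasure (S \<Otimes>\<^sub>M \<Xi>) {q. \<exists>k. (\<Sum>j<Suc k. fst q j) + snd q (Suc k) > x}"
    by (subst emeasure_Q_alt) (simp_all del: sum.lessThan_Suc)
  also have "\<dots> \<le> ennreal (R x)"
  proof -
    have "{q \<in> space (S \<Otimes>\<^sub>M \<Xi>). \<exists>k. (\<Sum>j<k. fst q j) + snd q k > x} \<in> sets (S \<Otimes>\<^sub>M \<Xi>)" by measurable
    then show ?thesis unfolding ennreal_R by (intro emeasure_mono) (auto simp del: sum.lessThan_Suc)
  qed
  finally have "(\<integral>\<^sup>+z. ennreal (R (x - z)) \<partial>F) \<le> ennreal (R x)" .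
  moreover have "integrable F (\<lambda>z. R (x - z))"
  proof (rule integrable_const_bound[of _ 1])
    show "(\<lambda>z. R (x - z)) \<in> borel_measurable F"
      by (rule measurable_finite_borel, rule measurable_compose[OF _ R_measurable]) simp
    show "AE z in F. norm (R (x - z)) \<le> 1"
    proof (rule AE_I2)
      show "norm (R (x - z)) \<le> 1" for z
        using R_nonneg[of "x - z"] R_le_1[of "x - z"] unfolding real_norm_def by linarith
    qed
  qed
  ultimately show ?thesis
    using R_nonneg by (subst (asm) nn_integral_eq_integral) (auto simp: ennreal_le_iff)
qed

text \<open>The term k = 0 is finite, so the events at the levels -n cover the whole space and
  cannot all be null.\<close>

lemma R_pos: "\<exists>x. 0 < R x"
proof (rule ccontr)
  assume "\<nexists>x. 0 < R x"
  then have "R x = 0" for x using R_nonneg[of x] by (metis less_le)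
  then have "emeasure (S \<Otimes>\<^sub>M \<Xi>) {q \<in> space (S \<Otimes>\<^sub>M \<Xi>). \<exists>k. (\<Sum>j<k. fst q j) + snd q k > x} = 0" for x
    using ennreal_R[of x] by simp
  then have "{q \<in> space (S \<Otimes>\<^sub>M \<Xi>). \<exists>k. (\<Sum>j<k. fst q j) + snd q k > x} \<in> null_sets (S \<Otimes>\<^sub>M \<Xi>)" for x
    by (intro null_setsI) measurable
  then have "(\<Union>n::nat. {q \<in> space (S \<Otimes>\<^sub>M \<Xi>). \<exists>k. (\<Sum>j<k. fst q j) + snd q k > - real n}) \<in> null_sets (S \<Otimes>\<^sub>M \<Xi>)"
    by (intro null_sets_UN)
  moreover have "(\<Union>n::nat. {q \<in> space (S \<Otimes>\<^sub>M \<Xi>). \<exists>k. (\<Sum>j<k. fst q j) + snd q k > - real n}) = space (S \<Otimes>\<^sub>M \<Xi>)"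
  proof -
    have "\<exists>n::nat. \<exists>k. (\<Sum>j<k. fst q j) + snd q k > - real n" for q :: "(nat \<Rightarrow> real) \<times> (nat \<Rightarrow> real)"
    proof -
      obtain n :: nat where "- snd q 0 < real n" using reals_Archimedean2 by blast
      then show ?thesis by (intro exI[of _ n] exI[of _ 0]) auto
    qed
    then show ?thesis by auto
  qed
  ultimately show False using Q.P.emeasure_space_1 by (simp add: null_sets_def)
qed

end

section \<open>The exponential tail\<close>

text \<open>The factor y is absorbed by moving the exponent by \<delta> in both directions. This
  gives the tilted law a finite mean.\<close>

lemma integrable_ident_mult_exp:
  fixes M :: "real measure" and \<theta> \<delta> :: real
  assumes [measurable_cong]: "sets M = sets borel" and "0 < \<delta>"
    and "integrable M (\<lambda>y. exp ((\<theta> + \<delta>) * y))" "integrable M (\<lambda>y. exp ((\<theta> - \<delta>) * y))"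
  shows "integrable M (\<lambda>y. y * exp (\<theta> * y))"
proof (rule Bochner_Integration.integrable_bound)
  show "integrable M (\<lambda>y. (exp ((\<theta> + \<delta>) * y) + exp ((\<theta> - \<delta>) * y)) / \<delta>)"
    using assms by simp
  show "AE y in M. norm (y * exp (\<theta> * y)) \<le> norm ((exp ((\<theta> + \<delta>) * y) + exp ((\<theta> - \<delta>) * y)) / \<delta>)"
  proof (rule AE_I2)
    fix y
    have "\<bar>\<delta> * y\<bar> \<le> exp (\<delta> * y) + exp (- (\<delta> * y))"
      using exp_ge_add_one_self[of "\<delta> * y"] exp_ge_add_one_self[of "- (\<delta> * y)"]
        exp_gt_zero[of "\<delta> * y"] exp_gt_zero[of "- (\<delta> * y)"] by linarith
    then have "\<bar>\<delta> * y\<bar> * exp (\<theta> * y) \<le> (exp (\<delta> * y) + exp (- (\<delta> * y))) * exp (\<theta> * y)"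
      by (rule mult_right_mono) simp
    then have "\<bar>\<delta> * y\<bar> * exp (\<theta> * y) \<le> exp ((\<theta> + \<delta>) * y) + exp ((\<theta> - \<delta>) * y)"
      unfolding distrib_right mult_exp_exp by (simp add: algebra_simps)
    then show "norm (y * exp (\<theta> * y)) \<le> norm ((exp ((\<theta> + \<delta>) * y) + exp ((\<theta> - \<delta>) * y)) / \<delta>)"
      using \<open>0 < \<delta>\<close> by (simp add: abs_mult field_simps abs_of_pos add_pos_pos)
  qed
qed measurable

lemma (in perturbed_walk) exponential_tail:
  assumes spread: "spread_out F" and \<eta>: "0 < \<eta>" "\<eta> < \<theta>"
    and int_\<eta>: "integrable F (\<lambda>y. exp (\<eta> * y))" and int_\<theta>: "integrable F (\<lambda>y. exp (\<theta> * y))"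
    and one: "(\<integral>y. exp (\<theta> * y) \<partial>F) = 1"
    and int_id: "integrable F (\<lambda>y. y * exp (\<theta> * y))"
    and \<Xi>_\<eta>: "integrable \<Xi> (\<lambda>e. exp (\<eta> * e 0))" and \<Xi>_\<theta>: "integrable \<Xi> (\<lambda>e. exp (\<theta> * e 0))"
  shows "\<exists>c>0. ((\<lambda>x. exp (\<theta> * x) * R x) \<longlongrightarrow> c) at_top"
proof -
  \<comment> \<open>A point mass at 0 would be carried by the Lebesgue null submonoid {0}.\<close>
  have nontriv: "\<not> (AE y in F. y = 0)"
    using spread_out_submonoid_non_null[OF spread real_distribution_axioms, of "{0}"] by auto
  have "0 < \<theta>" using \<eta> by simp
  note Lundberg = Lundberg_exponent[OF nontriv \<open>0 < \<theta>\<close> int_\<theta> one]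
  have \<rho>: "(\<integral>y. exp (\<eta> * y) \<partial>F) < 1" using Lundberg(1)[OF \<eta> int_\<eta>] .
  define G where "G = density F (\<lambda>y. ennreal (exp (\<theta> * y)))"
  have exp_F: "(\<lambda>y. exp (\<theta> * y)) \<in> borel_measurable F"
    by (rule measurable_finite_borel) simp
  have G_int: "(\<integral>y. f y \<partial>G) = (\<integral>y. exp (\<theta> * y) * f y \<partial>F)"
    if "f \<in> borel_measurable borel" for f :: "real \<Rightarrow> real"
    unfolding G_def
    by (subst integral_density[OF measurable_finite_borel[OF that] exp_F]) (simp_all only: real_scaleR_def exp_ge_zero AE_I2)
  have G_integrable: "integrable G f \<longleftrightarrow> integrable F (\<lambda>y. exp (\<theta> * y) * f y)"
    if "f \<in> borel_measurable borel" for f :: "real \<Rightarrow> real"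
    unfolding G_def
    by (subst integrable_density[OF measurable_finite_borel[OF that] exp_F]) (simp_all only: real_scaleR_def exp_ge_zero AE_I2)
  have G: "real_distribution G"
  proof (intro real_distribution.intro real_distribution_axioms.intro prob_spaceI)
    have "emeasure G (space G) = (\<integral>\<^sup>+y. ennreal (exp (\<theta> * y)) \<partial>F)"
      by (simp add: G_def emeasure_density)
    also have "\<dots> = ennreal (\<integral>y. exp (\<theta> * y) \<partial>F)"
      using int_\<theta> by (intro nn_integral_eq_integral) auto
    finally show "emeasure G (space G) = 1" by (simp add: one)
  qed (simp add: G_def)
  define K where "K = 1 / (1 - (\<integral>y. exp (\<eta> * y) \<partial>F))"
  have "0 \<le> K" using \<rho> by (simp add: K_def)
  \<comment> \<open>One constant has to serve both the bound of Z and its decay at -oo, hence the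
    maximum of the two prefactors.\<close>
  define C where "C = max (K * (\<integral>e. exp (\<eta> * e 0) \<partial>\<Xi>)) (K * (\<integral>e. exp (\<theta> * e 0) \<partial>\<Xi>))"
  have R_\<eta>: "R x \<le> C * exp (- \<eta> * x)" for x
  proof -
    have "R x \<le> K * (\<integral>e. exp (\<eta> * e 0) \<partial>\<Xi>) * exp (- \<eta> * x)"
      using sum_p_le[OF \<eta>(1) int_\<eta> \<rho>] \<open>0 \<le> K\<close> \<Xi>_\<eta> unfolding K_def by (rule R_le)
    also have "\<dots> \<le> C * exp (- \<eta> * x)" by (intro mult_right_mono) (auto simp: C_def)
    finally show ?thesis .
  qed
  have R_\<theta>: "R x \<le> C * exp (- \<theta> * x)" for x
  proof -
    have "R x \<le> K * (\<integral>e. exp (\<theta> * e 0) \<partial>\<Xi>) * exp (- \<theta> * x)"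
      using sum_p_le_critical[OF \<eta> int_\<eta> \<rho> int_\<theta> one] \<open>0 \<le> K\<close> \<Xi>_\<theta> unfolding K_def by (rule R_le)
    also have "\<dots> \<le> C * exp (- \<theta> * x)" by (intro mult_right_mono) (auto simp: C_def)
    finally show ?thesis .
  qed
  define Z where "Z x = exp (\<theta> * x) * R x" for x
  \<comment> \<open>Undoing the tilt: the moment of G at -(\<theta> - \<eta>) is the moment of F at
    \<eta>.\<close>
  have exp_\<kappa>: "exp (\<theta> * y) * exp (- (\<theta> - \<eta>) * y) = exp (\<eta> * y)" for y
    unfolding mult_exp_exp by (simp add: algebra_simps)
  interpret T: tilted_renewal G Z \<theta> "\<theta> - \<eta>" C
  proof (intro tilted_renewal.intro tilted_renewal_axioms.intro)
    show "integrable G (\<lambda>y. y)" using int_id by (simp add: G_integrable mult.commute)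
    show "0 < (\<integral>y. y \<partial>G)" using Lundberg(2)[OF int_id] by (simp add: G_int mult.commute)
    show "P = UNIV" if "closed P" "0 \<in> P" and diff: "\<And>x y. x \<in> P \<Longrightarrow> y \<in> P \<Longrightarrow> x - y \<in> P"
      and AE: "AE y in G. y \<in> P" for P
    proof (rule closed_subgroup_eq_UNIV[OF that(1-3)])
      \<comment> \<open>The tilting density is strictly positive, so G and F have the same null
        sets.\<close>
      have "AE y in F. y \<in> P"
        using AE unfolding G_def AE_density[OF measurable_compose[OF exp_F measurable_ennreal]] by simp
      moreover have "x + y \<in> P" if "x \<in> P" "y \<in> P" for x y
        using diff[OF that(1) diff[OF \<open>0 \<in> P\<close> that(2)]] by simp
      ultimately show "emeasure lborel P \<noteq> 0"
        using that(1,2) by (intro spread_out_submonoid_non_null[OF spread real_distribution_axioms]) auto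
    qed
    show "Z \<in> borel_measurable borel" unfolding Z_def[abs_def] by (intro borel_measurable_times R_measurable) simp
    show "Z x \<le> C" for x
    proof -
      have "Z x \<le> exp (\<theta> * x) * (C * exp (- \<theta> * x))"
        unfolding Z_def by (intro mult_left_mono R_\<theta>) simp
      also have "\<dots> = C * (exp (\<theta> * x) * exp (- \<theta> * x))" by simp
      also have "\<dots> = C" unfolding mult_exp_exp by simp
      finally show ?thesis .
    qed
    show "Z x \<le> C * exp ((\<theta> - \<eta>) * x)" for x
    proof -
      have "Z x \<le> exp (\<theta> * x) * (C * exp (- \<eta> * x))"
        unfolding Z_def by (intro mult_left_mono R_\<eta>) simp
      also have "\<dots> = C * (exp (\<theta> * x) * exp (- \<eta> * x))" by simp
      also have "\<dots> = C * exp ((\<theta> - \<eta>) * x)" unfolding mult_exp_exp by (simp add: algebra_simps)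
      finally show ?thesis .
    qed
    show "Z y \<le> exp (\<theta> * (y - x)) * Z x" if "x \<le> y" for x y
    proof -
      have eq: "exp (\<theta> * (y - x)) * Z x = exp (\<theta> * y) * R x"
        unfolding Z_def mult.assoc[symmetric] mult_exp_exp by (simp add: algebra_simps)
      show ?thesis using R_antimono[OF that] unfolding eq by (simp add: Z_def)
    qed
    show "integrable G (\<lambda>y. exp (- (\<theta> - \<eta>) * y))"
      by (subst G_integrable) (simp, simp only: exp_\<kappa> int_\<eta>)
    show "(\<integral>y. exp (- (\<theta> - \<eta>) * y) \<partial>G) < 1"
      by (subst G_int) (simp, simp only: exp_\<kappa> \<rho>)
    show "(\<integral>y. Z (x - y) \<partial>G) \<le> Z x" for x
    proof -
      have eq: "exp (\<theta> * y) * Z (x - y) = exp (\<theta> * x) * R (x - y)" for y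
        unfolding Z_def mult.assoc[symmetric] mult_exp_exp by (simp add: algebra_simps)
      have meas: "(\<lambda>y. Z (x - y)) \<in> borel_measurable borel"
        by (rule measurable_compose[OF _ \<open>Z \<in> borel_measurable borel\<close>]) simp
      have "(\<integral>y. Z (x - y) \<partial>G) = exp (\<theta> * x) * (\<integral>y. R (x - y) \<partial>F)"
        unfolding G_int[OF meas] eq by (rule integral_mult_right_zero)
      then show ?thesis using R_superharmonic[of x] by (simp add: Z_def)
    qed
    show "\<exists>x. 0 < Z x" using R_pos by (simp add: Z_def zero_less_mult_iff)
  qed (use G \<eta> R_nonneg in \<open>auto simp: Z_def\<close>)
  show ?thesis
    using T.tendsto_Z T.I_pos T.mean_pos unfolding Z_def[abs_def] by (intro exI conjI) (auto intro: divide_pos_pos)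
qed

section \<open>Transfer to the canonical space and conclusion\<close>

lemma (in prob_space) distr_sequence_pair:
  fixes X \<xi> :: "nat \<Rightarrow> 'a \<Rightarrow> real"
  assumes iid: "iid_sequence X" and indep: "indep_sequences X \<xi>"
  shows "distr M ((\<Pi>\<^sub>M j\<in>UNIV. borel) \<Otimes>\<^sub>M (\<Pi>\<^sub>M j\<in>UNIV. borel)) (\<lambda>\<omega>. (\<lambda>j. X (Suc j) \<omega>, \<lambda>j. \<xi> j \<omega>)) =
    (\<Pi>\<^sub>M j\<in>UNIV. distr M borel (X 1)) \<Otimes>\<^sub>M distr M (\<Pi>\<^sub>M j\<in>UNIV. borel) (\<lambda>\<omega> j. \<xi> j \<omega>)"
proof -
  let ?F = "distr M borel (X 1)" and ?B = "\<Pi>\<^sub>M j\<in>(UNIV :: nat set). (borel :: real measure)"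
  let ?B1 = "\<Pi>\<^sub>M j\<in>{1::nat..}. (borel :: real measure)"
  let ?X = "\<lambda>\<omega>. \<lambda>j\<in>{1..}. X j \<omega>"
  \<comment> \<open>Increments are numbered from 1, canonical coordinates from 0. The map reads only
    indices \<open>Suc j\<close>, so the \<open>undefined\<close> value of the restricted sequence
    at 0 is never met.\<close>
  define sh :: "(nat \<Rightarrow> real) \<Rightarrow> nat \<Rightarrow> real" where "sh w j = w (Suc j)" for w j
  have sh[measurable]: "sh \<in> ?B1 \<rightarrow>\<^sub>M ?B"
    unfolding sh_def[abs_def] by (rule measurable_PiM_single') auto
  have iv: "indep_vars (\<lambda>_. borel) X {1..}"
    and law_eq: "\<And>j. j \<ge> 1 \<Longrightarrow> distr M borel (X j) = ?F"
    using iid unfolding iid_sequence_def by blast+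
  have rv[measurable]: "random_variable borel (X j)" if "j \<ge> 1" for j
    using iv that unfolding indep_vars_def by simp
  have X[measurable]: "?X \<in> M \<rightarrow>\<^sub>M ?B1"
    by (rule measurable_restrict) (use rv in auto)
  have sh_X: "sh \<circ> ?X = (\<lambda>\<omega> j. X (Suc j) \<omega>)" by (auto simp: sh_def fun_eq_iff)
  have "distr M ?B1 ?X = (\<Pi>\<^sub>M j\<in>{1..}. distr M borel (X j))"
    by (rule indep_vars_iff_distr_eq_PiM'[THEN iffD1, OF _ _ iv]) (auto simp: rv)
  also have "\<dots> = (\<Pi>\<^sub>M j\<in>{1..}. ?F)"
    by (intro PiM_cong refl law_eq) simp
  finally have law_X: "distr M ?B1 ?X = (\<Pi>\<^sub>M j\<in>{1..}. ?F)" .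
  have "distr M ?B (sh \<circ> ?X) = distr (\<Pi>\<^sub>M j\<in>{1..}. ?F) ?B sh"
    unfolding law_X[symmetric] by (rule distr_distr[OF sh X, symmetric])
  also have "\<dots> = distr (\<Pi>\<^sub>M j\<in>{1..}. ?F) (\<Pi>\<^sub>M j\<in>UNIV. ?F) (\<lambda>\<omega>. \<lambda>n\<in>UNIV. \<omega> (Suc n))"
    by (intro distr_cong sets_PiM_cong) (auto simp: sh_def)
  also have "\<dots> = (\<Pi>\<^sub>M j\<in>UNIV. ?F)"
    by (rule distr_PiM_reindex) (auto intro!: prob_space_distr rv)
  finally have law: "distr M ?B (\<lambda>\<omega> j. X (Suc j) \<omega>) = (\<Pi>\<^sub>M j\<in>UNIV. ?F)" by (simp only: sh_X)
  have "indep_var ?B (sh \<circ> ?X) ?B ((\<lambda>e. e) \<circ> (\<lambda>\<omega> j. \<xi> j \<omega>))"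
    using indep unfolding indep_sequences_def by (rule indep_var_compose) (rule sh, simp)
  then have "indep_var ?B (\<lambda>\<omega> j. X (Suc j) \<omega>) ?B (\<lambda>\<omega> j. \<xi> j \<omega>)"
    unfolding sh_X by (simp add: o_def)
  then show ?thesis by (simp add: indep_var_distribution_eq law)
qed

theorem theorem2:
  fixes M :: "'a measure"
    and X \<xi> :: "nat \<Rightarrow> 'a \<Rightarrow> real"
    and \<theta>s \<epsilon> :: real
  assumes "prob_space M"
    and "prob_space.iid_sequence M X"
    and "\<theta>s > 0" and "\<epsilon> > 0"
    and "\<And>\<theta>. \<bar>\<theta> - \<theta>s\<bar> < \<epsilon> \<Longrightarrow> integrable M (\<lambda>\<omega>. exp (\<theta> * X 1 \<omega>))"
    and "(\<integral>\<omega>. exp (\<theta>s * X 1 \<omega>) \<partial>M) = 1"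
    and "prob_space.stationary_sequence M \<xi>"
    and "prob_space.indep_sequences M X \<xi>"
    and "\<forall>\<^sub>F \<theta> in nhds \<theta>s. \<forall>j. integrable M (\<lambda>\<omega>. exp (\<theta> * \<xi> j \<omega>))"
    and "spread_out (distr M borel (X 1))"
  shows "\<exists>c>0. (\<lambda>x. measure M {\<omega> \<in> space M. perturbed_max X \<xi> \<omega> > ereal x})
                 \<sim>[at_top] (\<lambda>x. c * exp (- \<theta>s * x))"
proof -
  interpret prob_space M by fact
  define F where "F = distr M borel (X 1)"
  define \<Xi> where "\<Xi> = distr M (\<Pi>\<^sub>M j\<in>UNIV. borel) (\<lambda>\<omega> j. \<xi> j \<omega>)"
  have rv_X[measurable]: "random_variable borel (X j)" if "j \<ge> 1" for j
    using assms(2) that unfolding iid_sequence_def indep_vars_def by (meson atLeast_iff)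
  have rv_\<xi>[measurable]: "random_variable borel (\<xi> j)" for j
    using assms(7) by (simp add: stationary_sequence_def)
  have [measurable]: "(\<lambda>\<omega> j. \<xi> j \<omega>) \<in> M \<rightarrow>\<^sub>M (\<Pi>\<^sub>M j\<in>UNIV. borel)"
    by (rule measurable_PiM_single') auto
  have [measurable]: "(\<lambda>\<omega> j. X (Suc j) \<omega>) \<in> M \<rightarrow>\<^sub>M (\<Pi>\<^sub>M j\<in>UNIV. borel)"
    by (rule measurable_PiM_single') auto
  interpret W: perturbed_walk F \<Xi>
  proof (intro perturbed_walk.intro perturbed_walk_axioms.intro)
    show "real_distribution F" unfolding F_def by (rule real_distribution_distr) simp
    show "prob_space \<Xi>" unfolding \<Xi>_def by (rule prob_space_distr) measurable
    have "distr \<Xi> (\<Pi>\<^sub>M j\<in>UNIV. borel) (\<lambda>e j. e (Suc j)) =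
        distr M (\<Pi>\<^sub>M j\<in>UNIV. borel) ((\<lambda>e j. e (Suc j)) \<circ> (\<lambda>\<omega> j. \<xi> j \<omega>))"
      unfolding \<Xi>_def by (rule distr_distr) (auto intro!: measurable_PiM_single')
    also have "\<dots> = distr M (\<Pi>\<^sub>M j\<in>UNIV. borel) (\<lambda>\<omega> j. \<xi> (j + 1) \<omega>)" by (simp add: o_def)
    also have "\<dots> = \<Xi>" using assms(7) unfolding stationary_sequence_def \<Xi>_def by blast
    finally show "distr \<Xi> (\<Pi>\<^sub>M j\<in>UNIV. borel) (\<lambda>e j. e (Suc j)) = \<Xi>" .
  qed (simp add: \<Xi>_def)
  \<comment> \<open>A supremum strictly exceeds x iff some term does, which turns the extended-real
    maximum into the existential event of \<open>W.R\<close>; the sum over 1..k becomes one over j <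
    k.\<close>
  have tail: "measure M {\<omega> \<in> space M. perturbed_max X \<xi> \<omega> > ereal x} = W.R x" for x
  proof -
    let ?BB = "(\<Pi>\<^sub>M j\<in>(UNIV::nat set). (borel :: real measure)) \<Otimes>\<^sub>M (\<Pi>\<^sub>M j\<in>(UNIV::nat set). (borel :: real measure))"
    let ?A = "{q \<in> space ?BB. \<exists>k. (\<Sum>j<k. fst q j) + snd q k > x}"
    have "?A \<in> sets ?BB" by measurable
    have "W.R x = measure (distr M ?BB (\<lambda>\<omega>. (\<lambda>j. X (Suc j) \<omega>, \<lambda>j. \<xi> j \<omega>))) ?A"
      unfolding W.R_def distr_sequence_pair[OF assms(2,8)] F_def[symmetric] \<Xi>_def[symmetric]
      by (simp add: space_pair_measure space_PiM)
    also have "\<dots> = measure M ((\<lambda>\<omega>. (\<lambda>j. X (Suc j) \<omega>, \<lambda>j. \<xi> j \<omega>)) -` ?A \<inter> space M)"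
      using \<open>?A \<in> sets ?BB\<close> by (intro measure_distr) measurable
    also have "(\<lambda>\<omega>. (\<lambda>j. X (Suc j) \<omega>, \<lambda>j. \<xi> j \<omega>)) -` ?A \<inter> space M = {\<omega> \<in> space M. perturbed_max X \<xi> \<omega> > ereal x}"
      by (auto simp: perturbed_max_def walk_def less_SUP_iff sum.atLeast1_atMost_eq space_pair_measure space_PiM)
    finally show ?thesis ..
  qed
  obtain d where d: "d > 0" "\<And>\<theta> j. dist \<theta> \<theta>s < d \<Longrightarrow> integrable M (\<lambda>\<omega>. exp (\<theta> * \<xi> j \<omega>))"
    using assms(9) unfolding eventually_nhds_metric by blast
  \<comment> \<open>Halving the minimum keeps \<theta>s - \<delta> positive and puts both \<theta>s
    - \<delta> and \<theta>s + \<delta> inside the two neighborhoods of finite moments. The lower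
    point is the auxiliary exponent \<eta>; the pair gives the first moment of the tilted
    law.\<close>
  define \<delta> where "\<delta> = min (min \<epsilon> d) \<theta>s / 2"
  have \<delta>: "0 < \<delta>" "\<delta> < \<epsilon>" "\<delta> < d" "\<delta> < \<theta>s"
    using assms(3,4) d(1) by (auto simp: \<delta>_def)
  have int_F: "integrable F (\<lambda>y. exp (\<theta> * y))" if "\<bar>\<theta> - \<theta>s\<bar> < \<epsilon>" for \<theta>
    unfolding F_def using assms(5)[OF that] by (subst integrable_distr_eq) auto
  have int_\<Xi>: "integrable \<Xi> (\<lambda>e. exp (\<theta> * e 0))" if "dist \<theta> \<theta>s < d" for \<theta>
    unfolding \<Xi>_def using d(2)[OF that] by (subst integrable_distr_eq) auto
  have "(\<integral>y. exp (\<theta>s * y) \<partial>F) = 1"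
    unfolding F_def using assms(6) by (subst integral_distr) auto
  moreover have "integrable F (\<lambda>y. y * exp (\<theta>s * y))"
    by (rule integrable_ident_mult_exp[OF W.events_eq_borel \<delta>(1)]) (use \<delta> in \<open>auto intro!: int_F\<close>)
  moreover have "spread_out F" using assms(10) by (simp only: F_def)
  ultimately obtain c where c: "c > 0" "((\<lambda>x. exp (\<theta>s * x) * W.R x) \<longlongrightarrow> c) at_top"
    using W.exponential_tail[of "\<theta>s - \<delta>" \<theta>s] \<delta> \<open>\<epsilon> > 0\<close> d(1)
    by (auto simp: int_F int_\<Xi> dist_real_def)
  have "((\<lambda>x. exp (\<theta>s * x) * W.R x / c) \<longlongrightarrow> c / c) at_top"
    using c by (intro tendsto_intros) auto
  then have "((\<lambda>x. W.R x / (c * exp (- \<theta>s * x))) \<longlongrightarrow> 1) at_top"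
    using c(1) by (simp add: exp_minus field_simps)
  then have "W.R \<sim>[at_top] (\<lambda>x. c * exp (- \<theta>s * x))"
    by (rule asymp_equivI')
  then show ?thesis using c(1) by (auto simp: tail)
qed

end
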